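(* Let $\{X_t : t\ge 0\}$ be a real-valued Lévy process with Lévy–Khinchine triplet $(A,\gamma,\mu(dx))$, and let $L$ be the infinitesimal generator of its transition semigroup $(P_t)_{t\ge 0}$ on $C_0$. Then $L$ has a convolution type form: there exists a real-valued function $k$ on $\mathbb{R}$ with $$\int_{-a}^{a}|k(t)|\,dt<\infty \quad\text{for every } a \text{ with } 0<a<\infty,$$ such that, with the operator $S$ defined by $$(Sg)(x)=\frac12 A\,g(x)+\int_{-\infty}^{\infty}k(y-x)\,g(y)\,dy,$$ one has $$Lf=\frac{d}{dx}\,S\,\frac{d}{dx}f$$ for every $f\in C_0^2$ that vanishes outside some bounded interval $[-a,a]$ ($a$ may depend on $f$).
   Context: $C_0$ is the Banach space of continuous functions $f$ on $\mathbb{R}$ with $f(x)\to 0$ as $|x|\to\infty$, with norm $\|f\|=\sup_x|f(x)|$. $C_0^2$ is the set of $f\in C_0$ with $f',f''\in C_0$. A Lévy process $\{X_t : t\ge0\}$ is a real-valued stochastic process with $X_0=0$ almost surely, independent increments, stationary increments, and almost surely right-continuous paths with left limits. Its characteristic function has the Lévy–Khinchine form $E\{\exp[izX_t]\}=\exp[-t\lambda(z)]$ for $t\ge 0$, $z\in\mathbb{R}$, where $$\lambda(z)=\frac12 Az^2-i\gamma z-\int_{-\infty}^{\infty}\bigl(e^{ixz}-1-ixz\,1_{|x|<1}\bigr)\mu(dx),$$ with $A\ge 0$, $\gamma\in\mathbb{R}$, and $\mu$ a measure on $(-\infty,\infty)$ satisfying $\int_{-\infty}^{\infty}\frac{x^2}{1+x^2}\mu(dx)<\infty$.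 The triplet $(A,\gamma,\mu(dx))$ is the Lévy–Khinchine triplet. The transition operators are $P_tf(x)=\int_{-\infty}^{\infty}P_t(x,dy)f(y)$, where $P_t(x_0,\Delta)$ is the probability that the process started at $x_0$ lies in $\Delta$ at time $t$ (so $P_tf(x)=E f(x+X_t)$). They form a strongly continuous semigroup on $C_0$. By the known Lévy–Itô representation, its infinitesimal generator $L$ acts on $f\in C_0^2$ by $$Lf(x)=\frac12 A f''(x)+\gamma f'(x)+\int_{-\infty}^{\infty}\bigl(f(x+y)-f(x)-y f'(x)1_{|y|<1}\bigr)\mu(dy).$$ *)

theory Defs
  imports "HOL-Probability.Probability"
begin

text \<open>
  Time ranges over the nonnegative reals; the values of \<open>X\<close> at negative times are unconstrained.
\<close>

locale levy_process = prob_space M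
  for M :: "'a measure" +
  fixes X :: "real \<Rightarrow> 'a \<Rightarrow> real"
  assumes random_variable_X: "\<And>t. 0 \<le> t \<Longrightarrow> random_variable borel (X t)"
    and start_zero: "AE \<omega> in M. X 0 \<omega> = 0"
    and independent_increments:
      "\<And>(n :: nat) (s :: nat \<Rightarrow> real). 0 \<le> s 0 \<Longrightarrow> (\<And>i. i < n \<Longrightarrow> s i < s (Suc i)) \<Longrightarrow>
        indep_vars (\<lambda>_. borel) (\<lambda>i \<omega>. X (s (Suc i)) \<omega> - X (s i) \<omega>) {..<n}"
    and stationary_increments:
      "\<And>s t. 0 \<le> s \<Longrightarrow> 0 \<le> t \<Longrightarrow>
        distr M borel (\<lambda>\<omega>. X (s + t) \<omega> - X s \<omega>) = distr M borel (\<lambda>\<omega>. X t \<omega> - X 0 \<omega>)"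
    and cadlag_paths:
      "AE \<omega> in M. (\<forall>t\<ge>0. continuous (at_right t) (\<lambda>s. X s \<omega>)) \<and>
        (\<forall>t>0. \<exists>l. ((\<lambda>s. X s \<omega>) \<longlongrightarrow> l) (at_left t))"

definition levy_exponent :: "real \<Rightarrow> real \<Rightarrow> real measure \<Rightarrow> real \<Rightarrow> complex" where
  "levy_exponent A \<gamma> \<mu> z =
    1/2 * complex_of_real A * (complex_of_real z)\<^sup>2 - \<i> * complex_of_real \<gamma> * complex_of_real z
    - (CLINT x|\<mu>. exp (\<i> * complex_of_real (x * z)) - 1
        - \<i> * complex_of_real (x * z) * indicator {x. \<bar>x\<bar> < 1} x)"

text \<open>
  No normalisation of \<open>\<mu> {0}\<close> is imposed: all integrands against \<open>\<mu>\<close> vanish at \<open>0\<close>, so this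
  value (which may even be infinite) is immaterial.
\<close>

definition levy_khinchine_triplet ::
    "'a measure \<Rightarrow> (real \<Rightarrow> 'a \<Rightarrow> real) \<Rightarrow> real \<Rightarrow> real \<Rightarrow> real measure \<Rightarrow> bool" where
  "levy_khinchine_triplet M X A \<gamma> \<mu> \<longleftrightarrow>
    0 \<le> A \<and> sets \<mu> = sets borel \<and> (\<integral>\<^sup>+x. ennreal (x\<^sup>2 / (1 + x\<^sup>2)) \<partial>\<mu>) < \<infinity> \<and>
    (\<forall>t\<ge>0. \<forall>z. char (distr M borel (X t)) z = exp (- complex_of_real t * levy_exponent A \<gamma> \<mu> z))"

definition C0 :: "(real \<Rightarrow> real) set" where
  "C0 = {f. continuous_on UNIV f \<and> (f \<longlongrightarrow> 0) at_infinity}"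

definition C0_norm :: "(real \<Rightarrow> real) \<Rightarrow> real" where
  "C0_norm f = (SUP x. \<bar>f x\<bar>)"

definition C0_2 :: "(real \<Rightarrow> real) set" where
  "C0_2 = {f. f differentiable_on UNIV \<and> deriv f differentiable_on UNIV \<and>
    f \<in> C0 \<and> deriv f \<in> C0 \<and> deriv (deriv f) \<in> C0}"

text \<open>The law at time \<open>t\<close> of the process started at \<open>x\<close>.\<close>

definition transition_prob ::
    "'a measure \<Rightarrow> (real \<Rightarrow> 'a \<Rightarrow> real) \<Rightarrow> real \<Rightarrow> real \<Rightarrow> real measure" where
  "transition_prob M X t x = distr M borel (\<lambda>\<omega>. x + X t \<omega>)"

definition transition_op ::
    "'a measure \<Rightarrow> (real \<Rightarrow> 'a \<Rightarrow> real) \<Rightarrow> real \<Rightarrow> (real \<Rightarrow> real) \<Rightarrow> real \<Rightarrow> real" where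
  "transition_op M X t f x = (LINT y|transition_prob M X t x. f y)"

definition generates ::
    "(real \<Rightarrow> (real \<Rightarrow> real) \<Rightarrow> real \<Rightarrow> real) \<Rightarrow> (real \<Rightarrow> real) \<Rightarrow> (real \<Rightarrow> real) \<Rightarrow> bool" where
  "generates P f g \<longleftrightarrow> f \<in> C0 \<and> g \<in> C0 \<and>
    ((\<lambda>t. C0_norm (\<lambda>x. (P t f x - f x) / t - g x)) \<longlongrightarrow> 0) (at_right 0)"

definition generator_domain ::
    "(real \<Rightarrow> (real \<Rightarrow> real) \<Rightarrow> real \<Rightarrow> real) \<Rightarrow> (real \<Rightarrow> real) set" where
  "generator_domain P = {f. \<exists>g. generates P f g}"

definition generator ::
    "(real \<Rightarrow> (real \<Rightarrow> real) \<Rightarrow> real \<Rightarrow> real) \<Rightarrow> (real \<Rightarrow> real) \<Rightarrow> real \<Rightarrow> real" where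
  "generator P f = (THE g. generates P f g)"

definition S_op :: "real \<Rightarrow> (real \<Rightarrow> real) \<Rightarrow> (real \<Rightarrow> real) \<Rightarrow> real \<Rightarrow> real" where
  "S_op A k g x = 1/2 * A * g x + (LINT y|lborel. k (y - x) * g y)"

end

theory Submission
  imports Defs "HOL-Real_Asymp.Real_Asymp"
begin

text \<open>
  The proof has two independent parts: the generator is identified on all of \<open>C0_2\<close>, and the
  resulting integro-differential operator is written as a convolution.

  \<^bold>\<open>The generator.\<close> Let \<open>w(y) = 1 - exp (- y\<^sup>2 / 2)\<close> and let \<open>P\<^sub>t\<close> be the law of \<open>X\<^sub>t\<close>. The measures
  \<open>P\<^sub>t(dy) w(y) / t\<close> converge weakly, as \<open>t\<close> tends to \<open>0\<close>, to \<open>w(y) \<mu>(dy) + A / 2 \<cdot> \<delta>\<^sub>0\<close>. Since \<open>1 - w\<close> is the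
  characteristic function of the standard normal law \<open>N\<close>, the Fourier transform at \<open>z\<close> of
  \<open>P\<^sub>t(dy) w(y) / t\<close> is the \<open>N(dv)\<close>-average of \<open>(char P\<^sub>t z - char P\<^sub>t (z + v)) / t\<close>. By the
  Levy--Khinchine formula this tends to the average of \<open>\<psi> (z + v) - \<psi> z\<close> (\<open>weighted_char_tendsto\<close>), which
  is the Fourier transform of the asserted limit (\<open>integral_levy_exponent_diff\<close>); Levy's
  continuity theorem concludes. Now
  \<open>(P\<^sub>t f(x) - f(x)) / t\<close> is the integral of \<open>(f(x + y) - f(x) - f'(x) sin y) / w(y)\<close> against
  \<open>P\<^sub>t(dy) w(y) / t\<close>, plus \<open>f'(x)\<close> times the mean of \<open>sin X\<^sub>t\<close> divided by \<open>t\<close>. The integrands are bounded and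
  equicontinuous as \<open>x\<close> varies (\<open>levy_quotient_equicontinuous\<close>), so the convergence is uniform in \<open>x\<close>
  (\<open>scaled_law_integral_tendsto\<close>). This yields the generator \<open>b f' + A / 2 \<cdot> f'' + J f\<close>, where
  \<open>J f(x)\<close> is the integral of \<open>f(x + y) - f(x) - f'(x) sin y\<close> against \<open>\<mu>(dy)\<close> (\<open>generates_levy_generator\<close>).

  \<^bold>\<open>The kernel.\<close> For \<open>f\<close> of compact support each jump is a convolution of \<open>f''\<close>: the expression
  \<open>f(x + y) - f(x) - f'(x) sin y\<close> is the integral over \<open>u\<close> of \<open>K(y, u) f''(x + u)\<close> with an explicit \<open>K\<close>
  supported on \<open>y u > 0\<close> (\<open>jump_kernel_represents\<close>). The integral of \<open>\<bar>K(y, u)\<bar>\<close> over bounded sets of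
  \<open>u\<close> is at most a constant times \<open>w(y)\<close>, hence integrable in \<open>\<mu>(dy)\<close>. Fubini's theorem gives
  \<open>k(u)\<close> as the integral of \<open>K(y, u)\<close> against \<open>\<mu>(dy)\<close>, corrected by a step function for the drift, and
  differentiation under the integral sign turns \<open>k\<close> applied to \<open>f''\<close> into the derivative of \<open>k\<close> applied
  to \<open>f'\<close> (\<open>S_op_has_derivative\<close>).
\<close>

section \<open>A weight of order y squared at the origin\<close>

text \<open>
  A bounded weight comparable to \<open>min 1 (y\<^sup>2)\<close> turns a Levy measure into a finite measure and
  compensated difference quotients into bounded functions. This one is moreover \<open>1\<close> minus the
  characteristic function of the standard normal law, so that the characteristic function of a
  weighted law is an average of translates of the original one.
\<close>

definition gauss_weight :: "real \<Rightarrow> real" where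
  "gauss_weight y = 1 - exp (- y\<^sup>2 / 2)"

lemma gauss_weight_0 [simp]: "gauss_weight 0 = 0"
  by (simp add: gauss_weight_def)

lemma gauss_weight_nonneg [simp]: "0 \<le> gauss_weight y"
  by (simp add: gauss_weight_def)

lemma gauss_weight_le_1: "gauss_weight y \<le> 1"
  by (simp add: gauss_weight_def)

lemma gauss_weight_pos: "y \<noteq> 0 \<Longrightarrow> 0 < gauss_weight y"
  by (simp add: gauss_weight_def)

lemma gauss_weight_eq_0_iff [simp]: "gauss_weight y = 0 \<longleftrightarrow> y = 0"
  using gauss_weight_pos[of y] by (cases "y = 0") auto

lemma gauss_weight_measurable [measurable]: "gauss_weight \<in> borel_measurable borel"
  unfolding gauss_weight_def[abs_def] by measurable

lemma continuous_gauss_weight: "continuous_on UNIV gauss_weight"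
  unfolding gauss_weight_def[abs_def] by (intro continuous_intros) auto

lemma gauss_weight_le: "gauss_weight y \<le> 2 * (y\<^sup>2 / (1 + y\<^sup>2))"
proof -
  have "1 - y\<^sup>2 / 2 \<le> exp (- y\<^sup>2 / 2)"
    using exp_ge_add_one_self[of "- y\<^sup>2 / 2"] by simp
  hence *: "gauss_weight y \<le> y\<^sup>2 / 2"
    by (simp add: gauss_weight_def)
  have pos: "0 < 1 + y\<^sup>2"
    by (simp add: add_pos_nonneg)
  show ?thesis
  proof (cases "y\<^sup>2 \<le> 1")
    case True
    hence "y\<^sup>2 * (1 + y\<^sup>2) \<le> y\<^sup>2 * 4"
      by (intro mult_left_mono) auto
    hence "y\<^sup>2 / 2 \<le> 2 * (y\<^sup>2 / (1 + y\<^sup>2))"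
      using pos by (simp add: field_simps)
    thus ?thesis using * by linarith
  next
    case False
    hence "1 \<le> 2 * (y\<^sup>2 / (1 + y\<^sup>2))"
      using pos by (simp add: field_simps)
    thus ?thesis using gauss_weight_le_1[of y] by linarith
  qed
qed

text \<open>
  The bound comes from \<open>1 - exp (- s) \<ge> s / (1 + s)\<close> with \<open>s = y\<^sup>2 / 2\<close>. Bounded
  integrands of order \<open>y\<^sup>2\<close> at the origin are therefore dominated by a multiple of the weight.
\<close>

lemma min_le_gauss_weight: "min 1 (y\<^sup>2) \<le> 3 * gauss_weight y"
proof -
  define s where "s = y\<^sup>2 / 2"
  have s: "0 \<le> s" by (simp add: s_def)
  have "(1 + s) * exp (- s) \<le> 1"
    using exp_ge_add_one_self[of s] mult_right_mono[of "1 + s" "exp s" "exp (- s)"]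
    by (simp add: exp_minus field_simps)
  hence "s \<le> (1 + s) * gauss_weight y"
    by (simp add: gauss_weight_def s_def field_simps)
  hence *: "s / (1 + s) \<le> gauss_weight y"
    using s by (simp add: field_simps)
  have "min 1 (y\<^sup>2) \<le> 3 * (s / (1 + s))"
  proof (cases "y\<^sup>2 \<le> 1")
    case True
    hence "s * s \<le> s * (1/2)" using s by (intro mult_left_mono) (auto simp: s_def)
    hence "2 * s \<le> 3 * (s / (1 + s))"
      using s by (simp add: field_simps)
    thus ?thesis by (simp add: s_def)
  next
    case False
    hence "1/2 \<le> s" by (simp add: s_def)
    hence "1 \<le> 3 * (s / (1 + s))"
      by (simp add: field_simps)
    thus ?thesis by simp
  qed
  thus ?thesis using * by linarith
qed

lemma dominated_by_gauss_weight:
  assumes "r \<le> C" "r \<le> C * y\<^sup>2" "0 \<le> C"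
  shows "r \<le> 3 * C * gauss_weight y"
proof -
  have "r \<le> C * min 1 (y\<^sup>2)"
    using assms by (auto simp: min_def)
  also have "\<dots> \<le> C * (3 * gauss_weight y)"
    by (intro mult_left_mono min_le_gauss_weight assms)
  finally show ?thesis by simp
qed

section \<open>Adding an atom to a finite measure\<close>

text \<open>
  The measures \<open>P\<^sub>t(dy) w(y) / t\<close> converge to a limit with mass \<open>A / 2\<close> at the origin: this atom is
  the trace of the Gaussian part. Levy's continuity theorem and
  Skorohod's representation concern probability measures, and the limit may be the null measure
  (pure drift); a further unit atom at the origin, added to the limit and to all measures of the
  sequence, makes the normalisation possible in every case.
\<close>

definition add_atom :: "real measure \<Rightarrow> real \<Rightarrow> real measure" where
  "add_atom \<kappa> a = measure_of UNIV (sets borel)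
     (\<lambda>E. emeasure \<kappa> E + ennreal a * emeasure (return borel 0) E)"

lemma sets_add_atom [simp, measurable_cong]: "sets (add_atom \<kappa> a) = sets borel"
  unfolding add_atom_def using sets.sigma_sets_eq[of "borel :: real measure"]
  by (subst sets_measure_of) auto

lemma space_add_atom [simp]: "space (add_atom \<kappa> a) = UNIV"
  using sets_eq_imp_space_eq[OF sets_add_atom, of \<kappa> a] by simp

lemma emeasure_add_atom:
  assumes \<kappa>: "sets \<kappa> = sets borel" and E: "E \<in> sets borel"
  shows "emeasure (add_atom \<kappa> a) E = emeasure \<kappa> E + ennreal a * indicator E 0"
proof -
  have "emeasure (add_atom \<kappa> a) E = emeasure \<kappa> E + ennreal a * emeasure (return borel 0) E"
  proof (rule emeasure_measure_of[OF add_atom_def])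
    show "countably_additive (sets (add_atom \<kappa> a))
      (\<lambda>E. emeasure \<kappa> E + ennreal a * emeasure (return borel 0) E)"
    proof (rule countably_additiveI)
      fix F :: "nat \<Rightarrow> real set"
      assume F: "range F \<subseteq> sets (add_atom \<kappa> a)" and disj: "disjoint_family F"
      have F1: "range F \<subseteq> sets \<kappa>" and F2: "range F \<subseteq> sets (return borel 0)"
        using F \<kappa> by auto
      have "(\<Sum>i. emeasure \<kappa> (F i) + ennreal a * emeasure (return borel 0) (F i)) =
          (\<Sum>i. emeasure \<kappa> (F i)) + ennreal a * (\<Sum>i. emeasure (return borel 0) (F i))"
        by (subst suminf_add[symmetric]) auto
      also have "\<dots> = emeasure \<kappa> (\<Union>i. F i) + ennreal a * emeasure (return borel 0) (\<Union>i. F i)"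
        using F1 F2 disj by (simp only: suminf_emeasure)
      finally show "(\<Sum>i. emeasure \<kappa> (F i) + ennreal a * emeasure (return borel 0) (F i)) =
        emeasure \<kappa> (\<Union> (range F)) + ennreal a * emeasure (return borel 0) (\<Union> (range F))" .
    qed
  qed (use E in \<open>auto simp: positive_def\<close>)
  thus ?thesis using E by simp
qed

lemma nn_integral_add_atom:
  assumes \<kappa>: "sets \<kappa> = sets borel" and h: "h \<in> borel_measurable borel"
  shows "nn_integral (add_atom \<kappa> a) h = nn_integral \<kappa> h + ennreal a * h 0"
  using h
proof (induction rule: borel_measurable_induct)
  case (cong f g)
  have "f = g" using cong by (auto simp: fun_eq_iff)
  thus ?case using cong by simp
next
  case (set E)
  thus ?case using \<kappa> by (simp add: emeasure_add_atom)
next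
  case (mult f c)
  note [measurable_cong] = \<kappa>
  have [measurable]: "f \<in> borel_measurable borel" by (rule mult)
  show ?case using mult by (simp add: nn_integral_cmult distrib_left mult.left_commute)
next
  case (add f g)
  note [measurable_cong] = \<kappa>
  have [measurable]: "f \<in> borel_measurable borel" "g \<in> borel_measurable borel" by (rule add)+
  show ?case using add by (simp add: nn_integral_add distrib_left add_ac)
next
  case (seq U)
  note [measurable_cong] = \<kappa>
  have [measurable]: "\<And>i. U i \<in> borel_measurable borel" by (rule seq)
  have U: "incseq U" by (rule seq)
  have *: "nn_integral N (Sup (range U)) = (SUP i. nn_integral N (U i))"
    if "sets N = sets borel" for N
  proof -
    have "Sup (range U) = (\<lambda>x. SUP i. U i x)"
      by (simp add: fun_eq_iff image_comp)
    thus ?thesis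
      using nn_integral_monotone_convergence_SUP[OF U, of N] that
      by (simp add: measurable_cong_sets[OF that refl])
  qed
  have "nn_integral (add_atom \<kappa> a) (Sup (range U)) = (SUP i. nn_integral \<kappa> (U i) + ennreal a * U i 0)"
    using seq by (simp add: *)
  also have "\<dots> = (SUP i. nn_integral \<kappa> (U i)) + (SUP i. ennreal a * U i 0)"
    using U by (intro ennreal_SUP_add)
      (auto simp: incseq_def le_fun_def intro!: nn_integral_mono mult_left_mono)
  also have "(SUP i. ennreal a * U i 0) = ennreal a * Sup (range U) 0"
    by (simp add: SUP_mult_left_ennreal image_comp)
  finally show ?case by (simp only: *[OF \<kappa>])
qed

lemma integrable_bounded_borel:
  fixes h :: "'b \<Rightarrow> 'c::{banach, second_countable_topology}"
  assumes "finite_measure \<kappa>" "h \<in> borel_measurable \<kappa>" "\<And>y. norm (h y) \<le> C"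
  shows "integrable \<kappa> h"
  using finite_measure.integrable_const_bound[OF assms(1), of h C] assms by auto

lemma finite_measure_add_atom:
  assumes "finite_measure \<kappa>" "sets \<kappa> = sets borel"
  shows "finite_measure (add_atom \<kappa> a)"
proof
  interpret finite_measure \<kappa> by fact
  show "emeasure (add_atom \<kappa> a) (space (add_atom \<kappa> a)) \<noteq> \<infinity>"
    using assms emeasure_finite[of UNIV] by (simp add: emeasure_add_atom)
qed

lemma measure_add_atom:
  assumes \<kappa>: "finite_measure \<kappa>" "sets \<kappa> = sets borel" and "0 \<le> a"
  shows "measure (add_atom \<kappa> a) UNIV = measure \<kappa> UNIV + a"
proof -
  interpret finite_measure \<kappa> by fact
  have "emeasure (add_atom \<kappa> a) UNIV = ennreal (measure \<kappa> UNIV + a)"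
    using assms by (simp add: emeasure_add_atom emeasure_eq_measure)
  thus ?thesis
    using \<open>0 \<le> a\<close> by (intro measure_eq_emeasure_eq_ennreal) auto
qed

text \<open>
  A bounded function becomes nonnegative after adding a constant, which reduces the claim to the
  nonnegative integral.
\<close>

lemma integral_add_atom_real:
  fixes h :: "real \<Rightarrow> real"
  assumes \<kappa>: "finite_measure \<kappa>" "sets \<kappa> = sets borel" and "0 \<le> a"
    and h [measurable]: "h \<in> borel_measurable borel" and bound: "\<And>y. \<bar>h y\<bar> \<le> C"
  shows "(LINT y|add_atom \<kappa> a. h y) = (LINT y|\<kappa>. h y) + a * h 0"
proof -
  note [measurable_cong] = \<kappa>(2)
  interpret \<kappa>: finite_measure \<kappa> by fact
  interpret A: finite_measure "add_atom \<kappa> a" by (rule finite_measure_add_atom[OF \<kappa>])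
  have sp: "space \<kappa> = UNIV" using sets_eq_imp_space_eq[OF \<kappa>(2)] by simp
  have int: "integrable \<kappa> h" "integrable (add_atom \<kappa> a) h"
    using bound by (auto intro!: integrable_bounded_borel \<kappa> A.finite_measure_axioms)
  have nonneg: "0 \<le> h y + C" for y
    using bound[of y] by linarith
  have "ennreal (LINT y|add_atom \<kappa> a. h y + C) = (\<integral>\<^sup>+y. ennreal (h y + C) \<partial>add_atom \<kappa> a)"
    using int nonneg by (intro nn_integral_eq_integral[symmetric]) auto
  also have "\<dots> = (\<integral>\<^sup>+y. ennreal (h y + C) \<partial>\<kappa>) + ennreal a * ennreal (h 0 + C)"
    by (rule nn_integral_add_atom[OF \<kappa>(2)]) measurable
  also have "(\<integral>\<^sup>+y. ennreal (h y + C) \<partial>\<kappa>) = ennreal (LINT y|\<kappa>. h y + C)"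
    using int nonneg by (intro nn_integral_eq_integral) auto
  also have "\<dots> + ennreal a * ennreal (h 0 + C) = ennreal ((LINT y|\<kappa>. h y + C) + a * (h 0 + C))"
    using nonneg \<open>0 \<le> a\<close> by (simp add: ennreal_mult' integral_nonneg_AE)
  finally have "(LINT y|add_atom \<kappa> a. h y + C) = (LINT y|\<kappa>. h y + C) + a * (h 0 + C)"
    using nonneg \<open>0 \<le> a\<close> by (subst (asm) ennreal_inj) (auto intro!: integral_nonneg_AE add_nonneg_nonneg)
  thus ?thesis
    using int measure_add_atom[OF \<kappa> \<open>0 \<le> a\<close>] by (simp add: sp algebra_simps)
qed

definition atom_mixture :: "real measure \<Rightarrow> real \<Rightarrow> real measure" where
  "atom_mixture \<kappa> a =
     density (add_atom \<kappa> a) (\<lambda>_. ennreal (1 / (measure \<kappa> UNIV + a)))"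

lemma real_distribution_atom_mixture:
  assumes \<kappa>: "finite_measure \<kappa>" "sets \<kappa> = sets borel" and a: "0 < a"
  shows "real_distribution (atom_mixture \<kappa> a)"
proof -
  interpret A: finite_measure "add_atom \<kappa> a" by (rule finite_measure_add_atom[OF \<kappa>])
  have "prob_space (atom_mixture \<kappa> a)"
  proof
    have pos: "0 < measure \<kappa> UNIV + a" using a by (simp add: add_nonneg_pos)
    have "emeasure (atom_mixture \<kappa> a) (space (atom_mixture \<kappa> a)) =
        ennreal (1 / (measure \<kappa> UNIV + a)) * emeasure (add_atom \<kappa> a) UNIV"
      by (simp add: atom_mixture_def emeasure_density nn_integral_cmult)
    also have "emeasure (add_atom \<kappa> a) UNIV = ennreal (measure \<kappa> UNIV + a)"
      using measure_add_atom[OF \<kappa>, of a] a by (simp add: A.emeasure_eq_measure)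
    also have "ennreal (1 / (measure \<kappa> UNIV + a)) * ennreal (measure \<kappa> UNIV + a) = 1"
      using pos by (simp add: ennreal_mult'[symmetric])
    finally show "emeasure (atom_mixture \<kappa> a) (space (atom_mixture \<kappa> a)) = 1" .
  qed
  thus ?thesis
    by (simp add: real_distribution_def real_distribution_axioms_def atom_mixture_def)
qed

lemma integral_atom_mixture:
  fixes h :: "real \<Rightarrow> real"
  assumes \<kappa>: "finite_measure \<kappa>" "sets \<kappa> = sets borel" and a: "0 < a"
    and h [measurable]: "h \<in> borel_measurable borel" and bound: "\<And>y. \<bar>h y\<bar> \<le> C"
  shows "(measure \<kappa> UNIV + a) * (LINT y|atom_mixture \<kappa> a. h y) = (LINT y|\<kappa>. h y) + a * h 0"
proof -
  have pos: "0 < measure \<kappa> UNIV + a" using a by (simp add: add_nonneg_pos)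
  have "(LINT y|atom_mixture \<kappa> a. h y) = (LINT y|add_atom \<kappa> a. 1 / (measure \<kappa> UNIV + a) * h y)"
    unfolding atom_mixture_def using pos by (subst integral_density) auto
  also have "\<dots> = 1 / (measure \<kappa> UNIV + a) * (LINT y|add_atom \<kappa> a. h y)"
    by (rule integral_mult_right_zero)
  finally show ?thesis
    using pos integral_add_atom_real[OF \<kappa> less_imp_le[OF a] h bound] by simp
qed

lemma integral_iexp_eq_Complex:
  assumes M: "finite_measure M" "sets M = sets borel"
  shows "(CLINT y|M. iexp (z * y)) = Complex (LINT y|M. cos (z * y)) (LINT y|M. sin (z * y))"
proof -
  note [measurable_cong] = M(2)
  have int: "integrable M (\<lambda>y. iexp (z * y))"
    by (rule integrable_bounded_borel[OF M(1), of _ 1]) auto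
  show ?thesis
    using int by (simp add: complex_eq_iff Re_exp Im_exp flip: integral_Re integral_Im)
qed

lemma char_atom_mixture:
  assumes \<kappa>: "finite_measure \<kappa>" "sets \<kappa> = sets borel" and a: "0 < a"
  shows "char (atom_mixture \<kappa> a) z =
    ((CLINT y|\<kappa>. iexp (z * y)) + complex_of_real a) / complex_of_real (measure \<kappa> UNIV + a)"
proof -
  interpret R: real_distribution "atom_mixture \<kappa> a"
    by (rule real_distribution_atom_mixture[OF assms])
  have pos: "0 < measure \<kappa> UNIV + a" using a by (simp add: add_nonneg_pos)
  have 1: "(measure \<kappa> UNIV + a) * (LINT y|atom_mixture \<kappa> a. cos (z * y)) = (LINT y|\<kappa>. cos (z * y)) + a"
    using integral_atom_mixture[OF assms, of "\<lambda>y. cos (z * y)" 1] by simp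
  have 2: "(measure \<kappa> UNIV + a) * (LINT y|atom_mixture \<kappa> a. sin (z * y)) = (LINT y|\<kappa>. sin (z * y))"
    using integral_atom_mixture[OF assms, of "\<lambda>y. sin (z * y)" 1] by simp
  have "complex_of_real (measure \<kappa> UNIV + a) * char (atom_mixture \<kappa> a) z =
      (CLINT y|\<kappa>. iexp (z * y)) + complex_of_real a"
    unfolding char_def integral_iexp_eq_Complex[OF \<kappa>] integral_iexp_eq_Complex[OF R.finite_measure_axioms R.events_eq_borel]
    using 1 2 by (simp add: complex_eq_iff)
  thus ?thesis using pos by (simp add: field_simps del: of_real_add)
qed

section \<open>Gaussian averages of the characteristic exponent\<close>

text \<open>
  Finite for a Levy measure \<open>\<mu>\<close>, and without atom at the origin, where the weight vanishes.
\<close>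

definition weighted_levy :: "real measure \<Rightarrow> real measure" where
  "weighted_levy \<mu> = density \<mu> (\<lambda>y. ennreal (gauss_weight y))"

text \<open>
  The Levy--Khinchine integrand relative to \<open>weighted_levy \<mu>\<close>. Its value at \<open>x = 0\<close> is \<open>0\<close>, by the
  convention \<open>0 / 0 = 0\<close>.
\<close>

definition lk_kernel :: "real \<Rightarrow> real \<Rightarrow> complex" where
  "lk_kernel x u = (exp (\<i> * complex_of_real (x * u)) - 1
     - \<i> * complex_of_real (x * u) * indicator {x. \<bar>x\<bar> < 1} x) / complex_of_real (gauss_weight x)"

lemma lk_kernel_measurable [measurable (raw)]:
  assumes [measurable]: "f \<in> borel_measurable M" "g \<in> borel_measurable M"
  shows "(\<lambda>p. lk_kernel (f p) (g p)) \<in> borel_measurable M"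
  unfolding lk_kernel_def by measurable

text \<open>
  The compensated exponential is at most \<open>(x * u)\<^sup>2 / 2\<close> for \<open>\<bar>x\<bar> < 1\<close>, and at most \<open>2\<close> otherwise.
  The growth in \<open>u\<close> is quadratic, hence integrable against the normal law.
\<close>

lemma norm_lk_kernel_le: "norm (lk_kernel x u) \<le> 6 * (1 + u\<^sup>2)"
proof (cases "x = 0")
  case False
  define r where "r = norm (exp (\<i> * complex_of_real (x * u)) - 1
     - \<i> * complex_of_real (x * u) * indicator {x. \<bar>x\<bar> < 1} x)"
  have r: "r \<le> 2 * (1 + u\<^sup>2) \<and> r \<le> 2 * (1 + u\<^sup>2) * x\<^sup>2"
  proof (cases "\<bar>x\<bar> < 1")
    case True
    have "r \<le> (x * u)\<^sup>2 / 2"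
      using iexp_approx1[of "x * u" 1] True
      by (simp add: r_def algebra_simps power2_eq_square)
    moreover have "x\<^sup>2 \<le> 1" using True by (simp add: abs_square_le_1)
    hence "(x * u)\<^sup>2 \<le> u\<^sup>2" by (simp add: power_mult_distrib mult_left_le_one_le)
    moreover have "0 \<le> x\<^sup>2" "0 \<le> u\<^sup>2" "0 \<le> (x * u)\<^sup>2" by simp_all
    ultimately have "r \<le> 2 + 2 * u\<^sup>2" "r \<le> 2 * x\<^sup>2 + 2 * (x * u)\<^sup>2" by linarith+
    thus ?thesis
      by (simp add: power_mult_distrib algebra_simps)
  next
    case False
    have r2: "r \<le> 2"
      using False norm_triangle_ineq4[of "exp (\<i> * complex_of_real (x * u))" 1]
      unfolding r_def by simp
    have "1 \<le> x\<^sup>2" using False by (simp add: abs_square_less_1 flip: not_less)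
    hence "1 * 1 \<le> (1 + u\<^sup>2) * x\<^sup>2" by (intro mult_mono) auto
    hence "r \<le> 2 * ((1 + u\<^sup>2) * x\<^sup>2)" using r2 by linarith
    moreover have "r \<le> 2 * (1 + u\<^sup>2)" using r2 by (rule order_trans) simp
    ultimately show ?thesis by (simp only: mult.assoc)
  qed
  have "r \<le> 3 * (2 * (1 + u\<^sup>2)) * gauss_weight x"
    using r by (intro dominated_by_gauss_weight) (auto simp: add_nonneg_nonneg)
  moreover have "norm (lk_kernel x u) = r / gauss_weight x"
    by (simp add: lk_kernel_def r_def norm_divide)
  ultimately show ?thesis
    using gauss_weight_pos[OF False] by (simp add: field_simps)
qed (simp add: lk_kernel_def add_nonneg_nonneg)

text \<open>
  The derivative of the exponential is bounded by \<open>1\<close> on the closed left half-plane, which is where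
  the values \<open>- t * \<psi> z\<close> lie. The resulting bound on \<open>(exp (- t * \<psi> z) - exp (- t * \<psi> z')) / t\<close>
  is uniform in \<open>t\<close>.
\<close>

lemma norm_exp_diff_le:
  fixes a b :: complex
  assumes "Re a \<le> 0" "Re b \<le> 0"
  shows "norm (exp a - exp b) \<le> norm (a - b)"
proof -
  have "norm (exp a - exp b) \<le> 1 * norm (a - b)"
  proof (rule field_differentiable_bound[where S = "{z. Re z \<le> 0}" and f' = exp])
    show "convex {z. Re z \<le> 0}" by (rule convex_halfspace_Re_le)
  qed (use assms in \<open>auto intro!: DERIV_subset[OF DERIV_exp]\<close>)
  thus ?thesis by simp
qed

lemma exp_diff_quotient_tendsto:
  fixes a b :: complex
  assumes t: "t \<longlonglongrightarrow> 0" "\<And>n. t n > 0"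
  shows "(\<lambda>n. (exp (- complex_of_real (t n) * a) - exp (- complex_of_real (t n) * b)) / complex_of_real (t n))
    \<longlonglongrightarrow> b - a"
proof -
  have "((\<lambda>s. exp (- s * a) - exp (- s * b)) has_field_derivative (b - a)) (at 0)"
    by (auto intro!: derivative_eq_intros)
  hence "((\<lambda>h. (exp (- h * a) - exp (- h * b)) / h) \<longlongrightarrow> b - a) (at 0)"
    by (simp add: DERIV_def)
  moreover have "filterlim (\<lambda>n. complex_of_real (t n)) (at 0) sequentially"
    unfolding filterlim_at using tendsto_of_real[OF t(1), where 'a=complex] t(2)
    by (auto simp: less_imp_neq[symmetric] intro!: always_eventually)
  ultimately show ?thesis
    by (rule filterlim_compose)
qed

text \<open>
  The characteristic function of the standard normal law \<open>N\<close> is \<open>exp (- y\<^sup>2 / 2)\<close>, so averaging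
  \<open>char P (z + v)\<close> over \<open>v\<close> with law \<open>N\<close> multiplies \<open>P\<close> by \<open>exp (- y\<^sup>2 / 2)\<close>.
\<close>

lemma char_gauss_weight:
  assumes "real_distribution P"
  shows "(CLINT y|P. iexp (z * y) * complex_of_real (gauss_weight y)) =
    (CLINT v|std_normal_distribution. char P z - char P (z + v))"
proof -
  let ?N = std_normal_distribution
  interpret P: real_distribution P by fact
  interpret N: real_distribution ?N by (rule real_dist_normal_dist)
  interpret NP: pair_prob_space ?N P ..
  have [simp]: "measure ?N UNIV = 1" using N.prob_space by simp
  have int: "integrable (?N \<Otimes>\<^sub>M P) (\<lambda>(v, y). iexp ((z + v) * y))"
    by (rule integrable_bounded_borel[where C = 1]) (auto simp: NP.finite_measure_axioms split_beta)
  have int_P: "complex_integrable P (\<lambda>y. iexp (z * y))"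
    by (rule integrable_bounded_borel[where C = 1]) (auto simp: P.finite_measure_axioms)
  have int_P': "complex_integrable P (\<lambda>y. iexp (z * y) * exp (- (y\<^sup>2) / 2))"
    by (rule integrable_bounded_borel[where C = 1]) (auto simp: P.finite_measure_axioms norm_mult)
  have "(CLINT v|?N. char P (z + v)) = (CLINT y|P. CLINT v|?N. iexp ((z + v) * y))"
    unfolding char_def using NP.Fubini_integral[OF int] by simp
  also have "(\<lambda>y. CLINT v|?N. iexp ((z + v) * y)) = (\<lambda>y. iexp (z * y) * char ?N y)"
    unfolding char_def
    by (simp add: algebra_simps exp_add)
  also have "(CLINT y|P. iexp (z * y) * char ?N y) =
      (CLINT y|P. iexp (z * y) * complex_of_real (exp (- (y\<^sup>2) / 2)))"
    by (simp add: char_std_normal_distribution)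
  finally have *: "(CLINT v|?N. char P (z + v)) = \<dots>" .
  have "integrable ?N (\<lambda>v. char P (z + v))"
    using P.cmod_char_le_1
    by (intro integrable_bounded_borel[where C = 1]) (auto simp: N.finite_measure_axioms)
  hence "(CLINT v|?N. char P z - char P (z + v)) = char P z - (CLINT v|?N. char P (z + v))"
    by (subst Bochner_Integration.integral_diff) auto
  also have "\<dots> = (CLINT y|P. iexp (z * y) - iexp (z * y) * complex_of_real (exp (- (y\<^sup>2) / 2)))"
    unfolding * unfolding char_def
    using int_P int_P' by (subst Bochner_Integration.integral_diff) auto
  finally show ?thesis
    by (simp add: gauss_weight_def algebra_simps)
qed

lemma integrable_std_normal_quadratic:
  "integrable std_normal_distribution (\<lambda>v. C * (1 + (z + v)\<^sup>2) :: real)"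
proof -
  interpret N: real_distribution std_normal_distribution by (rule real_dist_normal_dist)
  have "integrable std_normal_distribution (\<lambda>v. C * (1 + z\<^sup>2 + 2 * z * v + v\<^sup>2) :: real)"
    using integrable_std_normal_distribution_moment[of 1] integrable_std_normal_distribution_moment[of 2]
    by simp
  thus ?thesis by (simp add: power2_sum algebra_simps)
qed

text \<open>
  The compensator is linear in \<open>v\<close> and averages to \<open>0\<close>, while \<open>iexp (x * v)\<close> averages to
  \<open>exp (- x\<^sup>2 / 2)\<close>. The remaining factor \<open>exp (- x\<^sup>2 / 2) - 1\<close> cancels the weight in the denominator.
\<close>

lemma integral_lk_kernel_diff:
  assumes "x \<noteq> 0"
  shows "(CLINT v|std_normal_distribution. lk_kernel x (z + v) - lk_kernel x z) = - iexp (z * x)"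
proof -
  let ?N = std_normal_distribution
  interpret N: real_distribution ?N by (rule real_dist_normal_dist)
  define c where "c = \<i> * complex_of_real x * indicator {x. \<bar>x\<bar> < 1} x"
  have 1: "complex_integrable ?N (\<lambda>v. iexp (x * v))"
    by (rule integrable_bounded_borel[where C = 1]) (auto simp: N.finite_measure_axioms)
  have 2: "complex_integrable ?N (\<lambda>v. complex_of_real v)"
    using integrable_std_normal_distribution_moment[of 1] by simp
  have 3: "(LINT v|?N. v) = 0"
    using integral_std_normal_distribution_moment_odd[of 1] by simp
  have "(CLINT v|?N. lk_kernel x (z + v) - lk_kernel x z) =
      (CLINT v|?N. (iexp (z * x) * (iexp (x * v) - 1) - c * complex_of_real v) / gauss_weight x)"
    by (simp add: lk_kernel_def c_def diff_divide_distrib[symmetric] algebra_simps exp_add)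
  also have "\<dots> = (iexp (z * x) * ((CLINT v|?N. iexp (x * v)) - 1) - c * (CLINT v|?N. complex_of_real v))
      / gauss_weight x"
    using 1 2 N.prob_space by simp
  also have "(CLINT v|?N. iexp (x * v)) = complex_of_real (exp (- (x\<^sup>2) / 2))"
    using char_std_normal_distribution by (simp add: char_def fun_eq_iff)
  also have "\<dots> - 1 = - complex_of_real (gauss_weight x)"
    by (simp add: gauss_weight_def)
  finally show ?thesis
    using assms by (simp add: 3)
qed

text \<open>
  The one-dimensional laws \<open>P t\<close> determine both the semigroup and its generator, so the analysis is
  carried out for a family of laws rather than for a process.
\<close>

locale levy_khinchine_laws =
  fixes P :: "real \<Rightarrow> real measure" and A \<gamma> :: real and \<mu> :: "real measure"
  assumes A_nonneg: "0 \<le> A"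
    and sets_mu: "sets \<mu> = sets borel"
    and mu_finite: "(\<integral>\<^sup>+x. ennreal (x\<^sup>2 / (1 + x\<^sup>2)) \<partial>\<mu>) < \<infinity>"
    and real_distribution_P: "\<And>t. 0 \<le> t \<Longrightarrow> real_distribution (P t)"
    and char_P: "\<And>t z. 0 \<le> t \<Longrightarrow>
      char (P t) z = exp (- complex_of_real t * levy_exponent A \<gamma> \<mu> z)"
begin

abbreviation "\<kappa> \<equiv> weighted_levy \<mu>"
abbreviation "\<psi> \<equiv> levy_exponent A \<gamma> \<mu>"

lemma sets_kappa [simp, measurable_cong]: "sets \<kappa> = sets borel"
  by (simp add: weighted_levy_def sets_mu)

lemma space_kappa [simp]: "space \<kappa> = UNIV"
  using sets_eq_imp_space_eq[OF sets_kappa] by simp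

lemma finite_measure_kappa: "finite_measure \<kappa>"
proof
  note [measurable_cong] = sets_mu
  have "emeasure \<kappa> (space \<kappa>) = (\<integral>\<^sup>+y. ennreal (gauss_weight y) \<partial>\<mu>)"
    using sets_eq_imp_space_eq[OF sets_mu] by (simp add: weighted_levy_def emeasure_density)
  also have "\<dots> \<le> (\<integral>\<^sup>+y. 2 * ennreal (y\<^sup>2 / (1 + y\<^sup>2)) \<partial>\<mu>)"
    using gauss_weight_le
    by (intro nn_integral_mono) (auto simp: ennreal_mult'[symmetric] simp flip: ennreal_numeral)
  also have "\<dots> = 2 * (\<integral>\<^sup>+y. ennreal (y\<^sup>2 / (1 + y\<^sup>2)) \<partial>\<mu>)"
    by (rule nn_integral_cmult) measurable
  also have "\<dots> < \<infinity>"
    using mu_finite by (simp add: ennreal_mult_less_top)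
  finally show "emeasure \<kappa> (space \<kappa>) \<noteq> \<infinity>" by simp
qed

sublocale kappa: finite_measure \<kappa>
  by (rule finite_measure_kappa)

lemma AE_kappa_nonzero: "AE y in \<kappa>. y \<noteq> 0"
proof -
  note [measurable_cong] = sets_mu
  show ?thesis
    unfolding weighted_levy_def by (subst AE_density) auto
qed

text \<open>
  The density of \<open>\<kappa>\<close> with respect to \<open>\<mu>\<close> cancels the denominator of the kernel. At the origin, where
  no cancellation is possible, the original integrand vanishes as well.
\<close>

lemma levy_exponent_eq:
  "\<psi> u = 1/2 * complex_of_real A * (complex_of_real u)\<^sup>2 - \<i> * complex_of_real \<gamma> * complex_of_real u
    - (CLINT x|\<kappa>. lk_kernel x u)"
proof -
  note [measurable_cong] = sets_mu
  have "(CLINT x|\<kappa>. lk_kernel x u) = (CLINT x|\<mu>. gauss_weight x *\<^sub>R lk_kernel x u)"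
    unfolding weighted_levy_def by (subst integral_density) auto
  also have "\<dots> = (CLINT x|\<mu>. exp (\<i> * complex_of_real (x * u)) - 1
        - \<i> * complex_of_real (x * u) * indicator {x. \<bar>x\<bar> < 1} x)"
    by (intro Bochner_Integration.integral_cong refl) (auto simp: lk_kernel_def scaleR_conv_of_real)
  finally show ?thesis
    by (simp add: levy_exponent_def)
qed

lemma lk_kernel_integrable: "complex_integrable \<kappa> (\<lambda>x. lk_kernel x u)"
  using norm_lk_kernel_le by (intro integrable_bounded_borel[OF finite_measure_kappa]) auto

lemma levy_exponent_measurable [measurable]: "\<psi> \<in> borel_measurable borel"
  unfolding levy_exponent_eq[abs_def] by measurable

lemma norm_levy_exponent_le:
  "norm (\<psi> u) \<le> (A + \<bar>\<gamma>\<bar> + 6 * measure \<kappa> UNIV) * (1 + u\<^sup>2)"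
proof -
  have "norm (CLINT x|\<kappa>. lk_kernel x u) \<le> (LINT x|\<kappa>. 6 * (1 + u\<^sup>2))"
    using norm_lk_kernel_le lk_kernel_integrable
    by (intro order_trans[OF integral_norm_bound] integral_mono integrable_norm) auto
  hence *: "norm (CLINT x|\<kappa>. lk_kernel x u) \<le> 6 * measure \<kappa> UNIV * (1 + u\<^sup>2)"
    by (simp add: algebra_simps)
  have "norm (\<psi> u) \<le> norm (1/2 * complex_of_real A * (complex_of_real u)\<^sup>2)
      + norm (\<i> * complex_of_real \<gamma> * complex_of_real u) + norm (CLINT x|\<kappa>. lk_kernel x u)"
    unfolding levy_exponent_eq by (intro order_trans[OF norm_triangle_ineq4] add_right_mono norm_triangle_ineq4)
  also have "\<dots> = 1/2 * A * u\<^sup>2 + \<bar>\<gamma>\<bar> * \<bar>u\<bar> + norm (CLINT x|\<kappa>. lk_kernel x u)"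
    using A_nonneg by (simp add: norm_mult norm_power)
  also have "\<dots> \<le> A * (1 + u\<^sup>2) + \<bar>\<gamma>\<bar> * (1 + u\<^sup>2) + 6 * measure \<kappa> UNIV * (1 + u\<^sup>2)"
  proof (intro add_mono * mult_left_mono)
    have "\<bar>u\<bar> * 2 \<le> 1 + u\<^sup>2"
      using zero_le_power2[of "\<bar>u\<bar> - 1"] by (simp add: power2_diff)
    thus "\<bar>u\<bar> \<le> 1 + u\<^sup>2" by simp
    have "A * u\<^sup>2 / 2 \<le> A * u\<^sup>2" "0 \<le> A * u\<^sup>2" using A_nonneg by auto
    thus "1/2 * A * u\<^sup>2 \<le> A * (1 + u\<^sup>2)" using A_nonneg by (simp add: algebra_simps)
  qed auto
  finally show ?thesis by (simp add: algebra_simps)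
qed

text \<open>
  Characteristic functions have modulus at most \<open>1\<close>, in particular \<open>exp (- \<psi> u)\<close>.
\<close>

lemma Re_levy_exponent_nonneg: "0 \<le> Re (\<psi> u)"
proof -
  have "norm (exp (- \<psi> u)) \<le> 1"
    using real_distribution.cmod_char_le_1[OF real_distribution_P[of 1], of u] char_P[of 1 u] by simp
  thus ?thesis by simp
qed

text \<open>
  The Gaussian average of the increments of the exponent is the Fourier transform of
  \<open>\<kappa> + A / 2 \<cdot> \<delta>\<^sub>0\<close>: the quadratic term contributes \<open>A / 2\<close> times the variance of the normal law, the
  linear term averages to \<open>0\<close>, and the jump part is evaluated under the integral by Fubini.
\<close>

lemma integral_levy_exponent_diff:
  "(CLINT v|std_normal_distribution. \<psi> (z + v) - \<psi> z) = A / 2 + (CLINT y|\<kappa>. iexp (z * y))"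
proof -
  let ?N = std_normal_distribution
  interpret N: real_distribution ?N by (rule real_dist_normal_dist)
  interpret KN: pair_sigma_finite \<kappa> ?N ..
  define G where "G = (\<lambda>x v. lk_kernel x (z + v) - lk_kernel x z)"
  have G_bound: "norm (G x v) \<le> 6 * (1 + (z + v)\<^sup>2) + 6 * (1 + z\<^sup>2)" for x v
    unfolding G_def by (intro order_trans[OF norm_triangle_ineq4] add_mono norm_lk_kernel_le)
  have q: "integrable ?N (\<lambda>v. 6 * (1 + (z + v)\<^sup>2) + 6 * (1 + z\<^sup>2))"
    using integrable_std_normal_quadratic[of 6 z] by (rule Bochner_Integration.integrable_add) simp
  have int_G: "integrable (\<kappa> \<Otimes>\<^sub>M ?N) (case_prod G)"
  proof (rule KN.Fubini_integrable)
    show Gm: "case_prod G \<in> borel_measurable (\<kappa> \<Otimes>\<^sub>M ?N)"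
      unfolding G_def split_beta by measurable
    have i: "integrable ?N (\<lambda>v. G x v)" for x
      by (rule Bochner_Integration.integrable_bound[OF q])
        (use G_bound in \<open>auto simp: G_def intro: order_trans abs_ge_self\<close>)
    thus "AE x in \<kappa>. integrable ?N (\<lambda>y. case (x, y) of (x, y) \<Rightarrow> G x y)" by simp
    have "\<bar>LINT v|?N. norm (G x v)\<bar> \<le> (LINT v|?N. 6 * (1 + (z + v)\<^sup>2) + 6 * (1 + z\<^sup>2))" for x
      using G_bound q i by (subst abs_of_nonneg) (auto intro!: integral_mono integrable_norm)
    moreover have "(\<lambda>x. LINT v|?N. norm (G x v)) \<in> borel_measurable \<kappa>"
      unfolding G_def by measurable
    ultimately show "integrable \<kappa> (\<lambda>x. LINT y|?N. norm (case (x, y) of (x, y) \<Rightarrow> G x y))"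
      by (auto intro!: integrable_bounded_borel[OF finite_measure_kappa])
  qed
  define D where "D = (\<lambda>v. 1/2 * complex_of_real A * (2 * z * v + v\<^sup>2) - \<i> * complex_of_real \<gamma> * complex_of_real v)"
  have D: "integrable ?N D" "(CLINT v|?N. D v) = A / 2"
  proof -
    have *: "complex_integrable ?N (\<lambda>v. complex_of_real v)" "complex_integrable ?N (\<lambda>v. complex_of_real (v\<^sup>2))"
      using integrable_std_normal_distribution_moment[of 1] integrable_std_normal_distribution_moment[of 2]
      by (auto simp del: of_real_power)
    have **: "(CLINT v|?N. complex_of_real v) = 0" "(CLINT v|?N. complex_of_real (v\<^sup>2)) = 1"
      using integral_std_normal_distribution_moment_odd[of 1] std_normal_distribution_even_moments(1)[of 1]
      by (simp_all del: of_real_power)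
    have D_eq: "D = (\<lambda>v. (complex_of_real A * z - \<i> * complex_of_real \<gamma>) * complex_of_real v
        + (1/2 * complex_of_real A) * complex_of_real (v\<^sup>2))"
      by (auto simp: D_def fun_eq_iff algebra_simps)
    show "integrable ?N D"
      unfolding D_eq using * by (intro Bochner_Integration.integrable_add integrable_mult_right) auto
    show "(CLINT v|?N. D v) = A / 2"
      unfolding D_eq using * **
      by (subst Bochner_Integration.integral_add) (auto simp del: of_real_power)
  qed
  have eq: "\<psi> (z + v) - \<psi> z = D v - (CLINT x|\<kappa>. G x v)" for v
    unfolding levy_exponent_eq G_def D_def using lk_kernel_integrable
    by (simp add: algebra_simps power2_eq_square)
  have "(CLINT v|?N. \<psi> (z + v) - \<psi> z) = A / 2 - (CLINT v|?N. CLINT x|\<kappa>. G x v)"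
    unfolding eq using D KN.integrable_snd[OF int_G] by simp
  also have "(CLINT v|?N. CLINT x|\<kappa>. G x v) = (CLINT x|\<kappa>. CLINT v|?N. G x v)"
    by (rule KN.Fubini_integral[OF int_G])
  also have "\<dots> = (CLINT x|\<kappa>. - iexp (z * x))"
  proof (rule integral_cong_AE)
    show "AE x in \<kappa>. (CLINT v|?N. G x v) = - iexp (z * x)"
      using AE_kappa_nonzero unfolding G_def by eventually_elim (rule integral_lk_kernel_diff)
  qed (unfold G_def, measurable)
  finally show ?thesis by simp
qed

text \<open>
  The weighted law has as Fourier transform the average of \<open>char (P t) z - char (P t) (z + v)\<close>.
  Divided by \<open>t\<close>, this tends to \<open>\<psi> (z + v) - \<psi> z\<close> for each \<open>v\<close>, with an integrable bound of
  quadratic growth.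
\<close>

lemma weighted_char_tendsto:
  assumes t: "t \<longlonglongrightarrow> 0" "\<And>n. t n > 0"
  shows "(\<lambda>n. (CLINT y|P (t n). iexp (z * y) * complex_of_real (gauss_weight y)) / complex_of_real (t n))
    \<longlonglongrightarrow> A / 2 + (CLINT y|\<kappa>. iexp (z * y))"
proof -
  let ?N = std_normal_distribution
  interpret N: real_distribution ?N by (rule real_dist_normal_dist)
  define C where "C = A + \<bar>\<gamma>\<bar> + 6 * measure \<kappa> UNIV"
  define s where "s = (\<lambda>n v. (exp (- complex_of_real (t n) * \<psi> z)
      - exp (- complex_of_real (t n) * \<psi> (z + v))) / complex_of_real (t n))"
  have eq: "(CLINT y|P (t n). iexp (z * y) * complex_of_real (gauss_weight y)) / complex_of_real (t n)
      = (CLINT v|?N. s n v)" for n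
  proof -
    have "0 \<le> t n" using t(2)[of n] by simp
    thus ?thesis
      unfolding char_gauss_weight[OF real_distribution_P[OF \<open>0 \<le> t n\<close>]] by (simp add: char_P s_def)
  qed
  have "(\<lambda>n. CLINT v|?N. s n v) \<longlonglongrightarrow> (CLINT v|?N. \<psi> (z + v) - \<psi> z)"
  proof (rule integral_dominated_convergence)
    show "integrable ?N (\<lambda>v. C * (1 + (z + v)\<^sup>2) + C * (1 + z\<^sup>2))"
      using integrable_std_normal_quadratic[of C z] by (rule Bochner_Integration.integrable_add) simp
    show "AE v in ?N. (\<lambda>n. s n v) \<longlonglongrightarrow> \<psi> (z + v) - \<psi> z"
      unfolding s_def using t by (intro AE_I2 exp_diff_quotient_tendsto)
    show "AE v in ?N. norm (s n v) \<le> C * (1 + (z + v)\<^sup>2) + C * (1 + z\<^sup>2)" for n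
    proof (rule AE_I2)
      fix v
      have tn: "0 < t n" by (rule t)
      have "norm (exp (- complex_of_real (t n) * \<psi> z) - exp (- complex_of_real (t n) * \<psi> (z + v)))
          \<le> norm (- complex_of_real (t n) * \<psi> z - - complex_of_real (t n) * \<psi> (z + v))"
        using tn Re_levy_exponent_nonneg by (intro norm_exp_diff_le) auto
      also have "\<dots> = norm (complex_of_real (t n) * (\<psi> (z + v) - \<psi> z))"
        by (simp add: algebra_simps)
      also have "\<dots> = t n * norm (\<psi> (z + v) - \<psi> z)"
        using tn by (simp add: norm_mult)
      finally have "norm (s n v) \<le> norm (\<psi> (z + v) - \<psi> z)"
        using tn by (simp add: s_def norm_divide field_simps)
      also have "\<dots> \<le> norm (\<psi> (z + v)) + norm (\<psi> z)"
        by (rule norm_triangle_ineq4)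
      also have "\<dots> \<le> C * (1 + (z + v)\<^sup>2) + C * (1 + z\<^sup>2)"
        unfolding C_def by (intro add_mono norm_levy_exponent_le)
      finally show "norm (s n v) \<le> \<dots>" .
    qed
  qed (unfold s_def, measurable)
  thus ?thesis
    unfolding eq integral_levy_exponent_diff .
qed

end

section \<open>Functions vanishing at infinity\<close>

lemma C0_continuous: "f \<in> C0 \<Longrightarrow> isCont f x"
  by (auto simp: C0_def continuous_on_eq_continuous_at)

lemma C0_measurable: "f \<in> C0 \<Longrightarrow> f \<in> borel_measurable borel"
  by (auto simp: C0_def intro: borel_measurable_continuous_onI)

lemma C0_tail:
  assumes "f \<in> C0" "0 < e"
  obtains R where "\<And>x. R \<le> \<bar>x\<bar> \<Longrightarrow> \<bar>f x\<bar> < e"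
proof -
  have "eventually (\<lambda>x. dist (f x) 0 < e) at_infinity"
    using assms by (auto simp: C0_def dest: tendstoD)
  thus ?thesis
    using that by (auto simp: eventually_at_infinity)
qed

lemma C0_bounded:
  assumes "f \<in> C0"
  obtains B where "0 \<le> B" "\<And>x. \<bar>f x\<bar> \<le> B"
proof -
  obtain R where R: "\<And>x. R \<le> \<bar>x\<bar> \<Longrightarrow> \<bar>f x\<bar> < 1"
    using C0_tail[OF assms, of 1] by auto
  have "compact (f ` {-R..R})"
    using assms by (intro compact_continuous_image) (auto simp: C0_def intro: continuous_on_subset)
  then obtain B where B: "\<And>x. x \<in> {-R..R} \<Longrightarrow> \<bar>f x\<bar> \<le> B"
    by (force dest: compact_imp_bounded simp: bounded_iff)
  have "\<bar>f x\<bar> \<le> max B 1" for x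
  proof (cases "R \<le> \<bar>x\<bar>")
    case True
    thus ?thesis using R[of x] by linarith
  next
    case False
    hence "x \<in> {-R..R}" by auto
    thus ?thesis using B[of x] by (simp add: le_max_iff_disj)
  qed
  thus ?thesis using that[of "max B 1"] by auto
qed

text \<open>
  Two points at distance less than \<open>1\<close> either both lie in a fixed compact interval or both lie in
  the region where the function is small.
\<close>

lemma C0_uniformly_continuous:
  assumes "f \<in> C0"
  shows "uniformly_continuous_on UNIV f"
  unfolding uniformly_continuous_on_def
proof (intro allI impI)
  fix e :: real assume e: "0 < e"
  obtain R where R: "\<And>x. R \<le> \<bar>x\<bar> \<Longrightarrow> \<bar>f x\<bar> < e / 2"
    using C0_tail[OF assms, of "e / 2"] e by auto
  have "uniformly_continuous_on {-R-1..R+1} f"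
    using assms by (intro compact_uniformly_continuous) (auto simp: C0_def intro: continuous_on_subset)
  then obtain d where d: "0 < d" "\<And>x x'. x \<in> {-R-1..R+1} \<Longrightarrow> x' \<in> {-R-1..R+1} \<Longrightarrow>
      dist x' x < d \<Longrightarrow> dist (f x') (f x) < e"
    using e unfolding uniformly_continuous_on_def by metis
  have "dist (f x') (f x) < e" if *: "dist x' x < min d 1" for x x'
  proof (cases "x \<in> {-R-1..R+1} \<and> x' \<in> {-R-1..R+1}")
    case True
    thus ?thesis using d(2)[of x x'] * by auto
  next
    case False
    hence "R \<le> \<bar>x\<bar>" "R \<le> \<bar>x'\<bar>"
      using * by (auto simp: dist_real_def)
    hence "\<bar>f x\<bar> < e / 2" "\<bar>f x'\<bar> < e / 2" using R by auto
    thus ?thesis unfolding dist_real_def by linarith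
  qed
  thus "\<exists>d>0. \<forall>x\<in>UNIV. \<forall>x'\<in>UNIV. dist x' x < d \<longrightarrow> dist (f x') (f x) < e"
    using d(1) by (intro exI[of _ "min d 1"]) auto
qed

lemma uniformly_continuous_diff_tendsto:
  fixes f :: "real \<Rightarrow> real"
  assumes f: "uniformly_continuous_on UNIV f" and u: "(\<lambda>n. u n - v n) \<longlonglongrightarrow> 0"
  shows "(\<lambda>n. f (u n) - f (v n)) \<longlonglongrightarrow> 0"
proof (rule LIMSEQ_I)
  fix e :: real assume "0 < e"
  then obtain d where d: "0 < d" "\<And>x x'. dist x' x < d \<Longrightarrow> dist (f x') (f x) < e"
    using f unfolding uniformly_continuous_on_def by (metis UNIV_I)
  obtain N where "\<And>n. n \<ge> N \<Longrightarrow> norm (u n - v n - 0) < d"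
    using LIMSEQ_D[OF u d(1)] by auto
  thus "\<exists>N. \<forall>n\<ge>N. norm (f (u n) - f (v n) - 0) < e"
    using d(2) by (intro exI[of _ N]) (auto simp: dist_real_def)
qed

lemma C0_shift:
  assumes "f \<in> C0"
  shows "(\<lambda>x. f (x + y)) \<in> C0"
proof -
  have "filterlim (\<lambda>x::real. x + y) at_infinity at_infinity"
    by (rule tendsto_add_filterlim_at_infinity'[OF filterlim_ident tendsto_const])
  hence "((\<lambda>x. f (x + y)) \<longlongrightarrow> 0) at_infinity"
    by (rule filterlim_compose[rotated]) (use assms in \<open>simp add: C0_def\<close>)
  moreover have "continuous_on UNIV (\<lambda>x. f (x + y))"
    by (rule continuous_on_compose2[of UNIV f]) (use assms in \<open>auto simp: C0_def intro!: continuous_intros\<close>)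
  ultimately show ?thesis
    by (simp add: C0_def)
qed

lemma C0_add: "f \<in> C0 \<Longrightarrow> g \<in> C0 \<Longrightarrow> (\<lambda>x. f x + g x) \<in> C0"
  by (auto simp: C0_def intro!: continuous_intros tendsto_add_zero)

lemma C0_diff: "f \<in> C0 \<Longrightarrow> g \<in> C0 \<Longrightarrow> (\<lambda>x. f x - g x) \<in> C0"
  using tendsto_diff[of f 0 at_infinity g 0] by (auto simp: C0_def intro!: continuous_intros)

lemma C0_cmult: "f \<in> C0 \<Longrightarrow> (\<lambda>x. c * f x) \<in> C0"
  by (auto simp: C0_def intro!: continuous_intros tendsto_mult_right_zero)

lemma C0_integral:
  assumes \<kappa>: "finite_measure \<kappa>" and C0: "\<And>y. (\<lambda>x. h x y) \<in> C0"
    and m: "\<And>x. h x \<in> borel_measurable \<kappa>" and bound: "\<And>x y. \<bar>h x y\<bar> \<le> B"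
  shows "(\<lambda>x. LINT y|\<kappa>. h x y) \<in> C0"
proof -
  interpret finite_measure \<kappa> by fact
  have B: "integrable \<kappa> (\<lambda>_. B)" by simp
  have "continuous_on UNIV (\<lambda>x. LINT y|\<kappa>. h x y)"
    unfolding continuous_on_sequentially
  proof (clarsimp simp: comp_def)
    fix X :: "nat \<Rightarrow> real" and x assume X: "X \<longlonglongrightarrow> x"
    show "(\<lambda>n. LINT y|\<kappa>. h (X n) y) \<longlonglongrightarrow> (LINT y|\<kappa>. h x y)"
    proof (rule integral_dominated_convergence[where w = "\<lambda>_. B"])
      show "AE y in \<kappa>. (\<lambda>n. h (X n) y) \<longlonglongrightarrow> h x y"
        using X by (auto intro: isCont_tendsto_compose[OF C0_continuous[OF C0]])
    qed (use m bound B in auto)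
  qed
  moreover have "((\<lambda>x. LINT y|\<kappa>. h x y) \<longlongrightarrow> 0) at_infinity"
  proof -
    have lim: "((\<lambda>x. h x y) \<longlongrightarrow> 0) at_top" "((\<lambda>x. h x y) \<longlongrightarrow> 0) at_bot" for y
      using C0[of y] by (auto simp: C0_def at_infinity_eq_at_top_bot filterlim_def le_sup_iff filtermap_sup)
    have "((\<lambda>x. LINT y|\<kappa>. h x y) \<longlongrightarrow> (LINT y|\<kappa>. 0)) at_top"
      by (rule integral_dominated_convergence_at_top[where w = "\<lambda>_. B"])
        (use m bound B lim in auto)
    moreover have "((\<lambda>x. LINT y|\<kappa>. h (- x) y) \<longlongrightarrow> (LINT y|\<kappa>. 0)) at_top"
      by (rule integral_dominated_convergence_at_top[where w = "\<lambda>_. B"])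
        (use m bound B lim in \<open>auto simp: filterlim_at_bot_mirror\<close>)
    ultimately show ?thesis
      by (simp add: at_infinity_eq_at_top_bot filterlim_sup filterlim_at_bot_mirror)
  qed
  ultimately show ?thesis by (simp add: C0_def)
qed

section \<open>Second-order difference quotients\<close>

lemma Taylor_second_order:
  fixes f f1 f2 :: "real \<Rightarrow> real"
  assumes "\<And>x. (f has_real_derivative f1 x) (at x)" "\<And>x. (f1 has_real_derivative f2 x) (at x)"
  obtains \<xi> where "\<bar>\<xi> - x\<bar> \<le> \<bar>y\<bar>" "f (x + y) = f x + f1 x * y + f2 \<xi> / 2 * y\<^sup>2"
proof (cases "y = 0")
  case True
  thus ?thesis using that[of x] by auto
next
  case False
  define D where "D = (\<lambda>m::nat. if m = 0 then f else if m = 1 then f1 else f2)"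
  have "\<exists>t. (if x + y < x then x + y < t \<and> t < x else x < t \<and> t < x + y) \<and>
    f (x + y) = (\<Sum>m<2. (D m x / fact m) * (x + y - x) ^ m) + (D 2 t / fact 2) * (x + y - x) ^ 2"
  proof (rule Taylor[where a = "min x (x + y)" and b = "max x (x + y)"])
    show "\<forall>m t. m < 2 \<and> min x (x + y) \<le> t \<and> t \<le> max x (x + y) \<longrightarrow> DERIV (D m) t :> D (Suc m) t"
      using assms by (auto simp: D_def less_2_cases_iff)
  qed (use False in \<open>auto simp: D_def\<close>)
  then obtain t where "if x + y < x then x + y < t \<and> t < x else x < t \<and> t < x + y"
    "f (x + y) = f x + f1 x * y + f2 t / 2 * y\<^sup>2"
    by (auto simp: D_def numeral_2_eq_2)
  thus ?thesis using that[of t] by (auto split: if_splits)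
qed

lemma abs_diff_sin_le: "\<bar>y - sin y\<bar> \<le> (y :: real)\<^sup>2"
proof -
  obtain t where "sin (0 + y) = sin 0 + cos 0 * y + (- sin t) / 2 * y\<^sup>2"
    by (rule Taylor_second_order[of sin cos "\<lambda>x. - sin x" 0 y]) (auto intro!: derivative_eq_intros)
  hence eq: "y - sin y = sin t / 2 * y\<^sup>2" by simp
  have "\<bar>y - sin y\<bar> = \<bar>sin t / 2\<bar> * y\<^sup>2" unfolding eq by (simp add: abs_mult)
  also have "\<dots> \<le> 1 * y\<^sup>2"
    using abs_sin_le_one[of t] unfolding abs_divide by (intro mult_right_mono) (linarith, simp)
  finally show ?thesis by simp
qed

text \<open>
  The integrand of the generator relative to the weight. The compensator \<open>sin y\<close> is smooth and
  bounded, in contrast to \<open>y\<close> cut off at \<open>\<bar>y\<bar> = 1\<close>, so the quotient is continuous in \<open>y\<close>; its limit at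
  \<open>y = 0\<close> is \<open>f''(x)\<close>, because \<open>gauss_weight y\<close> behaves like \<open>y\<^sup>2 / 2\<close>.
\<close>

definition levy_quotient :: "(real \<Rightarrow> real) \<Rightarrow> real \<Rightarrow> real \<Rightarrow> real" where
  "levy_quotient f x y = (if y = 0 then deriv (deriv f) x
     else (f (x + y) - f x - deriv f x * sin y) / gauss_weight y)"

lemma levy_quotient_at_0: "levy_quotient f x 0 = deriv (deriv f) x"
  by (simp add: levy_quotient_def)

lemma C0_2_D:
  assumes "f \<in> C0_2"
  shows "f \<in> C0" "deriv f \<in> C0" "deriv (deriv f) \<in> C0"
    "(f has_real_derivative deriv f x) (at x)"
    "(deriv f has_real_derivative deriv (deriv f) x) (at x)"
  using assms
  by (auto simp: C0_2_def differentiable_on_def real_differentiable_def DERIV_imp_deriv dest!: spec[of _ x])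

lemma levy_quotient_times_weight:
  "levy_quotient f x y * gauss_weight y = f (x + y) - f x - deriv f x * sin y"
  by (simp add: levy_quotient_def)

lemma levy_quotient_measurable:
  assumes "f \<in> C0"
  shows "levy_quotient f x \<in> borel_measurable borel"
proof -
  note [measurable] = C0_measurable[OF assms]
  show ?thesis unfolding levy_quotient_def by measurable
qed

lemma levy_quotient_C0:
  assumes f: "f \<in> C0_2"
  shows "(\<lambda>x. levy_quotient f x y) \<in> C0"
proof (cases "y = 0")
  case True
  thus ?thesis using C0_2_D[OF f] by (simp add: levy_quotient_def)
next
  case False
  have "(\<lambda>x. (1 / gauss_weight y) * (f (x + y) - f x - sin y * deriv f x)) \<in> C0"
    by (intro C0_cmult C0_diff C0_shift C0_2_D f)
  thus ?thesis using False by (simp add: levy_quotient_def mult.commute)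
qed

lemma levy_quotient_bounded:
  assumes f: "f \<in> C0_2"
  obtains B where "0 \<le> B" "\<And>x y. \<bar>levy_quotient f x y\<bar> \<le> B"
proof -
  obtain B0 where B0: "0 \<le> B0" "\<And>x. \<bar>f x\<bar> \<le> B0" by (rule C0_bounded[OF C0_2_D(1)[OF f]]) (rule that)
  obtain B1 where B1: "0 \<le> B1" "\<And>x. \<bar>deriv f x\<bar> \<le> B1" by (rule C0_bounded[OF C0_2_D(2)[OF f]]) (rule that)
  obtain B2 where B2: "0 \<le> B2" "\<And>x. \<bar>deriv (deriv f) x\<bar> \<le> B2" by (rule C0_bounded[OF C0_2_D(3)[OF f]]) (rule that)
  define C where "C = 2 * B0 + B1 + B2"
  have "\<bar>levy_quotient f x y\<bar> \<le> 3 * C" for x y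
  proof (cases "y = 0")
    case True
    thus ?thesis using B0 B1 B2(1) B2(2)[of x] by (simp add: levy_quotient_def C_def)
  next
    case False
    let ?r = "f (x + y) - f x - deriv f x * sin y"
    obtain \<xi> where \<xi>: "f (x + y) = f x + deriv f x * y + deriv (deriv f) \<xi> / 2 * y\<^sup>2"
      by (rule Taylor_second_order[OF C0_2_D(4,5)[OF f]])
    have "?r = deriv f x * (y - sin y) + deriv (deriv f) \<xi> / 2 * y\<^sup>2"
      by (simp add: \<xi> algebra_simps)
    hence "\<bar>?r\<bar> \<le> \<bar>deriv f x\<bar> * \<bar>y - sin y\<bar> + \<bar>deriv (deriv f) \<xi> / 2\<bar> * y\<^sup>2"
      by (metis abs_triangle_ineq abs_mult abs_power2)
    also have "\<dots> \<le> B1 * y\<^sup>2 + B2 * y\<^sup>2"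
      using B1 B2(1) B2(2)[of \<xi>] by (intro add_mono mult_mono abs_diff_sin_le mult_right_mono) auto
    also have "\<dots> \<le> C * y\<^sup>2"
      using B0(1) by (simp add: C_def algebra_simps)
    finally have 1: "\<bar>?r\<bar> \<le> C * y\<^sup>2" .
    have "\<bar>deriv f x * sin y\<bar> \<le> B1 * 1"
      unfolding abs_mult using B1 by (intro mult_mono) auto
    hence 2: "\<bar>?r\<bar> \<le> C"
      using B0(2)[of "x + y"] B0(2)[of x] B2(1) by (simp add: C_def)
    have "\<bar>?r\<bar> \<le> 3 * C * gauss_weight y"
      using 1 2 B0(1) B1(1) B2(1) by (intro dominated_by_gauss_weight) (auto simp: C_def)
    thus ?thesis
      using False gauss_weight_pos[OF False] by (simp add: levy_quotient_def field_simps)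
  qed
  moreover have "0 \<le> 3 * C" using B0(1) B1(1) B2(1) by (simp add: C_def)
  ultimately show ?thesis using that by blast
qed

lemma null_times_bounded:
  fixes u v :: "nat \<Rightarrow> real"
  assumes "u \<longlonglongrightarrow> 0" "\<And>n. \<bar>v n\<bar> \<le> B"
  shows "(\<lambda>n. u n * v n) \<longlonglongrightarrow> 0"
proof (rule tendsto_rabs_zero_cancel, rule tendsto_sandwich[of "\<lambda>_. 0"])
  show "(\<lambda>n. \<bar>u n\<bar> * B) \<longlonglongrightarrow> 0"
    using assms by (intro tendsto_mult_left_zero tendsto_rabs_zero)
qed (use assms in \<open>auto simp: abs_mult intro!: always_eventually mult_left_mono\<close>)

text \<open>
  Taylor's formula expresses the quotient through \<open>f''\<close> at a point \<open>\<xi>\<close> close to \<open>x\<close>. Uniform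
  continuity of \<open>f''\<close> makes the convergence uniform over all choices of the points \<open>X n\<close>.
\<close>

lemma levy_quotient_tendsto_at_0:
  assumes f: "f \<in> C0_2" and Y: "Y \<longlonglongrightarrow> 0"
  shows "(\<lambda>n. levy_quotient f (X n) (Y n) - levy_quotient f (X n) 0) \<longlonglongrightarrow> 0"
proof -
  obtain B1 where B1: "0 \<le> B1" "\<And>x. \<bar>deriv f x\<bar> \<le> B1" by (rule C0_bounded[OF C0_2_D(2)[OF f]]) (rule that)
  obtain B2 where B2: "0 \<le> B2" "\<And>x. \<bar>deriv (deriv f) x\<bar> \<le> B2" by (rule C0_bounded[OF C0_2_D(3)[OF f]]) (rule that)
  \<comment> \<open>coefficients of \<open>f''(\<xi>)\<close> and of \<open>f'(x)\<close> in Taylor's formula, extended continuously to \<open>0\<close>\<close>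
  define c1 where "c1 = (\<lambda>y. if y = 0 then 1 else y\<^sup>2 / 2 / gauss_weight y)"
  define c2 where "c2 = (\<lambda>y. if y = 0 then 0 else (y - sin y) / gauss_weight y)"
  have c1_0: "c1 0 = 1" and c2_0: "c2 0 = 0" by (simp_all add: c1_def c2_def)
  have "((\<lambda>y. y\<^sup>2 / 2 / gauss_weight y) \<longlongrightarrow> 1) (at 0)"
    unfolding gauss_weight_def by real_asymp
  hence "(c1 \<longlongrightarrow> 1) (at 0)"
    by (rule Lim_transform_eventually)
      (auto simp: c1_def eventually_at_filter)
  hence c1: "(\<lambda>n. c1 (Y n)) \<longlonglongrightarrow> c1 0"
    using Y by (intro isCont_tendsto_compose[of 0 c1]) (simp_all add: isCont_def c1_0)
  have "((\<lambda>y. (y - sin y) / gauss_weight y) \<longlongrightarrow> 0) (at 0)"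
    unfolding gauss_weight_def by real_asymp
  hence "(c2 \<longlongrightarrow> 0) (at 0)"
    by (rule Lim_transform_eventually)
      (auto simp: c2_def eventually_at_filter)
  hence c2: "(\<lambda>n. c2 (Y n)) \<longlonglongrightarrow> c2 0"
    using Y by (intro isCont_tendsto_compose[of 0 c2]) (simp_all add: isCont_def c2_0)
  have "\<exists>\<xi>. \<forall>n. \<bar>\<xi> n - X n\<bar> \<le> \<bar>Y n\<bar> \<and>
      f (X n + Y n) = f (X n) + deriv f (X n) * Y n + deriv (deriv f) (\<xi> n) / 2 * (Y n)\<^sup>2"
    by (rule choice) (metis Taylor_second_order[OF C0_2_D(4,5)[OF f]])
  then obtain \<xi> where \<xi>: "\<And>n. \<bar>\<xi> n - X n\<bar> \<le> \<bar>Y n\<bar>"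
      "\<And>n. f (X n + Y n) = f (X n) + deriv f (X n) * Y n + deriv (deriv f) (\<xi> n) / 2 * (Y n)\<^sup>2"
    by blast
  define d where "d = (\<lambda>n. deriv (deriv f) (\<xi> n) - deriv (deriv f) (X n))"
  have eq: "levy_quotient f (X n) (Y n) - levy_quotient f (X n) 0 =
      (c1 (Y n) - 1) * deriv (deriv f) (\<xi> n) + d n + c2 (Y n) * deriv f (X n)" for n
  proof -
    have T: "f (X n + Y n) - f (X n) - deriv f (X n) * sin (Y n) =
        deriv (deriv f) (\<xi> n) * ((Y n)\<^sup>2 / 2) + deriv f (X n) * (Y n - sin (Y n))"
      using \<xi>(2)[of n] by (simp add: algebra_simps)
    show ?thesis
    proof (cases "Y n = 0")
      case True
      thus ?thesis using \<xi>(1)[of n] by (simp add: c1_def c2_def d_def)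
    next
      case False
      thus ?thesis
        unfolding levy_quotient_def T
        by (simp add: c1_def c2_def d_def add_divide_distrib diff_divide_distrib algebra_simps)
    qed
  qed
  have "(\<lambda>n. \<xi> n - X n) \<longlonglongrightarrow> 0"
    by (rule tendsto_rabs_zero_cancel, rule tendsto_sandwich[of "\<lambda>_. 0" _ _ "\<lambda>n. \<bar>Y n\<bar>"])
      (use \<xi>(1) Y in \<open>auto intro!: tendsto_rabs_zero\<close>)
  hence "d \<longlonglongrightarrow> 0"
    unfolding d_def
    by (rule uniformly_continuous_diff_tendsto[OF C0_uniformly_continuous[OF C0_2_D(3)[OF f]]])
  moreover have "(\<lambda>n. (c1 (Y n) - 1) * deriv (deriv f) (\<xi> n)) \<longlonglongrightarrow> 0"
    using c1 B2 by (intro null_times_bounded) (auto simp: c1_def LIM_zero_iff)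
  moreover have "(\<lambda>n. c2 (Y n) * deriv f (X n)) \<longlonglongrightarrow> 0"
    using c2 B1 by (intro null_times_bounded) (auto simp: c2_def)
  ultimately show ?thesis
    unfolding eq by (intro tendsto_add_zero)
qed

text \<open>
  This is equicontinuity in \<open>y\<close> of the family of all \<open>levy_quotient f x\<close>, expressed by sequences of
  base points \<open>X n\<close>; it is what makes the convergence of the difference quotients uniform in \<open>x\<close>.
\<close>

lemma levy_quotient_equicontinuous:
  assumes f: "f \<in> C0_2" and Y: "Y \<longlonglongrightarrow> y"
  shows "(\<lambda>n. levy_quotient f (X n) (Y n) - levy_quotient f (X n) y) \<longlonglongrightarrow> 0"
proof (cases "y = 0")
  case True
  thus ?thesis using levy_quotient_tendsto_at_0[OF f] Y by simp
next
  case False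
  obtain B0 where B0: "0 \<le> B0" "\<And>x. \<bar>f x\<bar> \<le> B0" by (rule C0_bounded[OF C0_2_D(1)[OF f]]) (rule that)
  obtain B1 where B1: "0 \<le> B1" "\<And>x. \<bar>deriv f x\<bar> \<le> B1" by (rule C0_bounded[OF C0_2_D(2)[OF f]]) (rule that)
  define N where "N = (\<lambda>x y. f (x + y) - f x - deriv f x * sin y)"
  have N_bound: "\<bar>N x y\<bar> \<le> 2 * B0 + B1" for x y
  proof -
    have "\<bar>deriv f x * sin y\<bar> \<le> B1 * 1"
      unfolding abs_mult using B1 by (intro mult_mono) auto
    thus ?thesis using B0(2)[of "x + y"] B0(2)[of x] by (simp add: N_def)
  qed
  have w: "(\<lambda>n. 1 / gauss_weight (Y n)) \<longlonglongrightarrow> 1 / gauss_weight y"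
    using False continuous_gauss_weight Y
    by (intro tendsto_divide tendsto_const isCont_tendsto_compose[of y gauss_weight])
      (auto simp: continuous_on_eq_continuous_at)
  have "(\<lambda>n. (f (X n + Y n) - f (X n + y)) + (sin y - sin (Y n)) * deriv f (X n)) \<longlonglongrightarrow> 0"
  proof (intro tendsto_add_zero null_times_bounded)
    show "(\<lambda>n. f (X n + Y n) - f (X n + y)) \<longlonglongrightarrow> 0"
      by (rule uniformly_continuous_diff_tendsto[OF C0_uniformly_continuous[OF C0_2_D(1)[OF f]]])
        (use Y in \<open>simp add: LIM_zero_iff\<close>)
    have "(\<lambda>n. sin y - sin (Y n)) \<longlonglongrightarrow> sin y - sin y"
      using Y by (intro tendsto_intros)
    thus "(\<lambda>n. sin y - sin (Y n)) \<longlonglongrightarrow> 0" by simp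
  qed (rule B1)
  hence "(\<lambda>n. (N (X n) (Y n) - N (X n) y) * (1 / gauss_weight (Y n))) \<longlonglongrightarrow> 0 * (1 / gauss_weight y)"
    using w by (intro tendsto_mult) (simp_all add: N_def algebra_simps)
  moreover have "(\<lambda>n. (1 / gauss_weight (Y n) - 1 / gauss_weight y) * N (X n) y) \<longlonglongrightarrow> 0"
    using w N_bound by (intro null_times_bounded) (auto simp: LIM_zero_iff)
  ultimately have *: "(\<lambda>n. (N (X n) (Y n) - N (X n) y) * (1 / gauss_weight (Y n)) +
      (1 / gauss_weight (Y n) - 1 / gauss_weight y) * N (X n) y) \<longlonglongrightarrow> 0"
    by (intro tendsto_add_zero) simp_all
  have "eventually (\<lambda>n. Y n \<noteq> 0) sequentially"
    using Y False by (rule tendsto_imp_eventually_ne)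
  hence "eventually (\<lambda>n. (N (X n) (Y n) - N (X n) y) * (1 / gauss_weight (Y n)) +
      (1 / gauss_weight (Y n) - 1 / gauss_weight y) * N (X n) y =
      levy_quotient f (X n) (Y n) - levy_quotient f (X n) y) sequentially"
    by eventually_elim (use False in \<open>simp add: levy_quotient_def N_def algebra_simps diff_divide_distrib add_divide_distrib\<close>)
  with * show ?thesis
    by (rule Lim_transform_eventually)
qed

section \<open>Generators and uniform convergence\<close>

lemma C0_norm_upper:
  assumes "\<And>x. \<bar>f x\<bar> \<le> B"
  shows "\<bar>f x\<bar> \<le> C0_norm f"
  unfolding C0_norm_def by (rule cSUP_upper) (use assms in \<open>auto intro!: bdd_aboveI[of _ B]\<close>)

text \<open>
  Convergence in the supremum norm implies pointwise convergence once the supremum is taken over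
  a bounded set; this is where the boundedness of \<open>T t f\<close> enters.
\<close>

lemma generates_unique:
  assumes T: "\<And>t. 0 < t \<Longrightarrow> \<exists>B. \<forall>x. \<bar>T t f x\<bar> \<le> B"
    and g: "generates T f g" and h: "generates T f h"
  shows "g = h"
proof
  fix x
  have lim: "((\<lambda>t. (T t f x - f x) / t) \<longlongrightarrow> g x) (at_right 0)" if g: "generates T f g" for g
  proof -
    have "f \<in> C0" "g \<in> C0" using g by (auto simp: generates_def)
    then obtain Bf Bg where Bf: "\<And>x. \<bar>f x\<bar> \<le> Bf" and Bg: "\<And>x. \<bar>g x\<bar> \<le> Bg"
      using C0_bounded by metis
    have bd: "\<bar>(T t f x - f x) / t - g x\<bar> \<le> C0_norm (\<lambda>x. (T t f x - f x) / t - g x)" if t: "0 < t" for t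
    proof -
      obtain B where B: "\<And>x. \<bar>T t f x\<bar> \<le> B" using T[OF t] by blast
      have "\<bar>(T t f x - f x) / t - g x\<bar> \<le> (B + Bf) / t + Bg" for x
      proof -
        have "\<bar>(T t f x - f x) / t\<bar> \<le> (B + Bf) / t"
          using B[of x] Bf[of x] t by (simp add: abs_divide divide_right_mono)
        thus ?thesis using Bg[of x] by linarith
      qed
      thus ?thesis by (rule C0_norm_upper)
    qed
    have "((\<lambda>t. (T t f x - f x) / t - g x) \<longlongrightarrow> 0) (at_right 0)"
    proof (rule Lim_null_comparison)
      show "eventually (\<lambda>t. norm ((T t f x - f x) / t - g x) \<le>
          C0_norm (\<lambda>x. (T t f x - f x) / t - g x)) (at_right 0)"
        using bd by (auto simp: eventually_at_filter)
    qed (use g in \<open>simp add: generates_def\<close>)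
    thus ?thesis by (simp add: LIM_zero_iff)
  qed
  show "g x = h x"
    by (rule tendsto_unique[OF _ lim[OF g] lim[OF h]]) simp
qed

text \<open>
  Choosing \<open>X n\<close> as an almost maximal point at time \<open>t n\<close> reduces the convergence of norms to
  convergence along sequences, which is the form in which Skorohod's representation and dominated
  convergence apply.
\<close>

lemma generatesI_sequentially:
  assumes f: "f \<in> C0" and g: "g \<in> C0"
    and T: "\<And>t. 0 < t \<Longrightarrow> \<exists>B. \<forall>x. \<bar>T t f x\<bar> \<le> B"
    and lim: "\<And>t X. t \<longlonglongrightarrow> 0 \<Longrightarrow> (\<And>n. 0 < t n) \<Longrightarrow>
      (\<lambda>n. (T (t n) f (X n) - f (X n)) / t n - g (X n)) \<longlonglongrightarrow> 0"
  shows "generates T f g"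
proof -
  define D where "D = (\<lambda>t x. (T t f x - f x) / t - g x)"
  obtain Bf Bg where Bf: "\<And>x. \<bar>f x\<bar> \<le> Bf" and Bg: "\<And>x. \<bar>g x\<bar> \<le> Bg"
    using C0_bounded f g by metis
  have D_bounded: "bdd_above (range (\<lambda>x. \<bar>D t x\<bar>))" if t: "0 < t" for t
  proof -
    obtain B where B: "\<And>x. \<bar>T t f x\<bar> \<le> B" using T[OF t] by blast
    have "\<bar>D t x\<bar> \<le> (B + Bf) / t + Bg" for x
    proof -
      have "\<bar>(T t f x - f x) / t\<bar> \<le> (B + Bf) / t"
        using B[of x] Bf[of x] t by (simp add: abs_divide divide_right_mono)
      thus ?thesis using Bg[of x] unfolding D_def by linarith
    qed
    thus ?thesis by (intro bdd_aboveI[of _ "(B + Bf) / t + Bg"]) auto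
  qed
  have "((\<lambda>t. C0_norm (D t)) \<longlongrightarrow> 0) (at_right 0)"
    unfolding tendsto_at_iff_sequentially
  proof (intro allI impI)
    fix t :: "nat \<Rightarrow> real" assume "\<forall>i. t i \<in> {0<..} - {0}" and t0: "t \<longlonglongrightarrow> 0"
    hence t: "\<And>n. 0 < t n" by auto
    have "\<exists>x. C0_norm (D (t n)) - 1 / real (Suc n) < \<bar>D (t n) x\<bar>" for n
    proof -
      have "C0_norm (D (t n)) - 1 / real (Suc n) < (SUP x. \<bar>D (t n) x\<bar>)"
        by (simp add: C0_norm_def)
      thus ?thesis
        using less_cSUP_iff[OF _ D_bounded[OF t]] by auto
    qed
    then obtain X where X: "\<And>n. C0_norm (D (t n)) - 1 / real (Suc n) < \<bar>D (t n) (X n)\<bar>"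
      by metis
    have "(\<lambda>n. D (t n) (X n)) \<longlonglongrightarrow> 0"
      unfolding D_def using lim t0 t by blast
    hence "(\<lambda>n. \<bar>D (t n) (X n)\<bar> + 1 / real (Suc n)) \<longlonglongrightarrow> 0"
      using LIMSEQ_inverse_real_of_nat by (intro tendsto_add_zero tendsto_rabs_zero) (simp_all add: inverse_eq_divide)
    moreover have "norm (C0_norm (D (t n))) \<le> \<bar>D (t n) (X n)\<bar> + 1 / real (Suc n)" for n
    proof -
      have "0 \<le> C0_norm (D (t n))"
        unfolding C0_norm_def using D_bounded[OF t[of n]] by (intro cSUP_upper2[of _ _ 0]) auto
      thus ?thesis using X[of n] by simp
    qed
    hence "eventually (\<lambda>n. norm (C0_norm (D (t n))) \<le> \<bar>D (t n) (X n)\<bar> + 1 / real (Suc n)) sequentially"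
      by (rule always_eventually[OF allI])
    ultimately show "((\<lambda>t. C0_norm (D t)) \<circ> t) \<longlonglongrightarrow> 0"
      unfolding comp_def by (rule Lim_null_comparison[rotated])
  qed
  thus ?thesis using f g by (simp add: generates_def D_def)
qed

section \<open>The generator of a convolution semigroup\<close>

context levy_khinchine_laws begin

text \<open>
  Away from the origin, \<open>P\<^sub>t(dy) / t\<close> approximates the frequency of jumps of size \<open>y\<close>. Its mass near
  the origin explodes as \<open>t\<close> tends to \<open>0\<close>; the weight keeps the total mass bounded.
\<close>

definition scaled_law :: "real \<Rightarrow> real measure" where
  "scaled_law t = density (P t) (\<lambda>y. ennreal (gauss_weight y / t))"

lemma sets_P: "0 \<le> t \<Longrightarrow> sets (P t) = sets borel"
  using real_distribution_P real_distribution.events_eq_borel by blast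

lemma integral_scaled_law:
  fixes h :: "real \<Rightarrow> 'c::{banach, second_countable_topology}"
  assumes "0 < t" "h \<in> borel_measurable borel"
  shows "(LINT y|scaled_law t. h y) = (LINT y|P t. (gauss_weight y / t) *\<^sub>R h y)"
proof -
  note [measurable_cong] = sets_P[OF less_imp_le[OF assms(1)]]
  show ?thesis
    unfolding scaled_law_def using assms by (subst integral_density) auto
qed

lemma scaled_law:
  assumes t: "0 < t"
  shows sets_scaled_law: "sets (scaled_law t) = sets borel"
    and finite_measure_scaled_law: "finite_measure (scaled_law t)"
proof -
  interpret Pt: real_distribution "P t" using t by (intro real_distribution_P) simp
  show "sets (scaled_law t) = sets borel"
    by (simp add: scaled_law_def)
  show "finite_measure (scaled_law t)"
  proof
    have "emeasure (scaled_law t) (space (scaled_law t)) = (\<integral>\<^sup>+y. ennreal (gauss_weight y / t) \<partial>P t)"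
      by (simp add: scaled_law_def emeasure_density)
    also have "\<dots> \<le> (\<integral>\<^sup>+y. ennreal (1 / t) \<partial>P t)"
      using t gauss_weight_le_1 by (intro nn_integral_mono) (auto intro!: divide_right_mono)
    also have "\<dots> < \<infinity>"
      using Pt.emeasure_space_1 by (simp del: Pt.space_eq_univ)
    finally show "emeasure (scaled_law t) (space (scaled_law t)) \<noteq> \<infinity>" by simp
  qed
qed

lemma scaled_law_iexp:
  assumes "0 < t"
  shows "(CLINT y|scaled_law t. iexp (z * y)) =
    (CLINT y|P t. iexp (z * y) * complex_of_real (gauss_weight y)) / complex_of_real t"
proof -
  have "(CLINT y|scaled_law t. iexp (z * y)) =
      (CLINT y|P t. (gauss_weight y / t) *\<^sub>R iexp (z * y))"
    using assms by (rule integral_scaled_law) measurable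
  also have "\<dots> = (CLINT y|P t. (iexp (z * y) * complex_of_real (gauss_weight y)) / complex_of_real t)"
    by (simp add: scaleR_conv_of_real mult.commute)
  also have "\<dots> = (CLINT y|P t. iexp (z * y) * complex_of_real (gauss_weight y)) / complex_of_real t"
    by (rule integral_divide_zero)
  finally show ?thesis .
qed

lemma scaled_law_mass_tendsto:
  assumes t: "t \<longlonglongrightarrow> 0" "\<And>n. 0 < t n"
  shows "(\<lambda>n. measure (scaled_law (t n)) UNIV) \<longlonglongrightarrow> A / 2 + measure \<kappa> UNIV"
proof -
  have "(\<lambda>n. CLINT y|scaled_law (t n). iexp (0 * y)) \<longlonglongrightarrow> A / 2 + (CLINT y|\<kappa>. iexp (0 * y))"
    unfolding scaled_law_iexp[OF t(2)] by (rule weighted_char_tendsto[OF t])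
  moreover have "space (scaled_law (t n)) = UNIV" for n
    using sets_eq_imp_space_eq[OF sets_scaled_law[OF t(2)]] by simp
  ultimately have "(\<lambda>n. complex_of_real (measure (scaled_law (t n)) UNIV)) \<longlonglongrightarrow>
      complex_of_real (A / 2 + measure \<kappa> UNIV)"
    by (simp add: scaleR_conv_of_real)
  thus ?thesis by (simp only: tendsto_of_real_iff)
qed

lemma scaled_law_weak_conv:
  assumes t: "t \<longlonglongrightarrow> 0" "\<And>n. 0 < t n"
  shows "weak_conv_m (\<lambda>n. atom_mixture (scaled_law (t n)) 1) (atom_mixture \<kappa> (A / 2 + 1))"
proof (rule levy_continuity)
  have A: "0 < A / 2 + 1" using A_nonneg by simp
  show "real_distribution (atom_mixture (scaled_law (t n)) 1)" for n
    by (intro real_distribution_atom_mixture finite_measure_scaled_law sets_scaled_law t) simp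
  show "real_distribution (atom_mixture \<kappa> (A / 2 + 1))"
    by (rule real_distribution_atom_mixture[OF finite_measure_kappa sets_kappa A])
  fix z
  have *: "(\<lambda>n. ((CLINT y|scaled_law (t n). iexp (z * y)) + complex_of_real 1) /
      complex_of_real (measure (scaled_law (t n)) UNIV + 1)) \<longlonglongrightarrow>
    (A / 2 + (CLINT y|\<kappa>. iexp (z * y)) + complex_of_real 1) / complex_of_real (A / 2 + measure \<kappa> UNIV + 1)"
  proof (intro tendsto_divide tendsto_add tendsto_of_real tendsto_const scaled_law_mass_tendsto t)
    show "(\<lambda>n. CLINT y|scaled_law (t n). iexp (z * y)) \<longlonglongrightarrow> A / 2 + (CLINT y|\<kappa>. iexp (z * y))"
      unfolding scaled_law_iexp[OF t(2)] by (rule weighted_char_tendsto[OF t])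
    have "0 < A / 2 + measure \<kappa> UNIV + 1"
      using A_nonneg by (intro add_nonneg_pos add_nonneg_nonneg) auto
    thus "complex_of_real (A / 2 + measure \<kappa> UNIV + 1) \<noteq> 0"
      by (simp only: of_real_eq_0_iff)
  qed
  show "(\<lambda>n. char (atom_mixture (scaled_law (t n)) 1) z) \<longlonglongrightarrow> char (atom_mixture \<kappa> (A / 2 + 1)) z"
    unfolding char_atom_mixture[OF finite_measure_scaled_law[OF t(2)] sets_scaled_law[OF t(2)] zero_less_one]
      char_atom_mixture[OF finite_measure_kappa sets_kappa A]
    using * by (simp add: add_ac)
qed

text \<open>
  Weak convergence extends to integrands that vary with \<open>n\<close> within an equicontinuous family. Skorohod's
  representation realises the normalised measures by random variables \<open>Ys n\<close> converging pointwise to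
  \<open>Y\<close>; then \<open>h n (Ys n) - h n Y\<close> tends to \<open>0\<close> by equicontinuity, and its mean by dominated convergence.
\<close>

lemma scaled_law_integral_tendsto:
  fixes h :: "nat \<Rightarrow> real \<Rightarrow> real"
  assumes t: "t \<longlonglongrightarrow> 0" "\<And>n. 0 < t n"
    and h [measurable]: "\<And>n. h n \<in> borel_measurable borel"
    and bound: "\<And>n y. \<bar>h n y\<bar> \<le> B"
    and equi: "\<And>Y y. Y \<longlonglongrightarrow> y \<Longrightarrow> (\<lambda>n. h n (Y n) - h n y) \<longlonglongrightarrow> 0"
  shows "(\<lambda>n. (LINT y|scaled_law (t n). h n y) - ((LINT y|\<kappa>. h n y) + A / 2 * h n 0)) \<longlonglongrightarrow> 0"
proof -
  have A: "0 < A / 2 + 1" using A_nonneg by simp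
  define R where "R = (\<lambda>n. atom_mixture (scaled_law (t n)) 1)"
  define R' where "R' = atom_mixture \<kappa> (A / 2 + 1)"
  define c where "c = (\<lambda>n. measure (scaled_law (t n)) UNIV + 1)"
  define c' where "c' = measure \<kappa> UNIV + (A / 2 + 1)"
  have R: "real_distribution (R n)" for n
    unfolding R_def
    by (intro real_distribution_atom_mixture finite_measure_scaled_law sets_scaled_law t) simp
  have R': "real_distribution R'"
    unfolding R'_def by (rule real_distribution_atom_mixture[OF finite_measure_kappa sets_kappa A])
  have "weak_conv_m R R'"
    unfolding R_def R'_def by (rule scaled_law_weak_conv[OF t])
  from Skorohod[OF R R' this] obtain \<Omega> :: "real measure" and Ys :: "nat \<Rightarrow> real \<Rightarrow> real" and Y
    where Sk: "prob_space \<Omega> \<and> (\<forall>n. Ys n \<in> measurable \<Omega> borel) \<and> (\<forall>n. distr \<Omega> borel (Ys n) = R n) \<and>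
      Y \<in> measurable \<Omega> lborel \<and> distr \<Omega> borel Y = R' \<and> (\<forall>\<omega>\<in>space \<Omega>. (\<lambda>n. Ys n \<omega>) \<longlonglongrightarrow> Y \<omega>)"
    by (elim exE) (rule that)
  hence \<Omega>: "prob_space \<Omega>" and Ys [measurable]: "\<And>n. Ys n \<in> borel_measurable \<Omega>"
    and Y [measurable]: "Y \<in> borel_measurable \<Omega>"
    and dYs: "\<And>n. distr \<Omega> borel (Ys n) = R n" and dY: "distr \<Omega> borel Y = R'"
    and lim: "\<And>\<omega>. \<omega> \<in> space \<Omega> \<Longrightarrow> (\<lambda>n. Ys n \<omega>) \<longlonglongrightarrow> Y \<omega>"
    by simp_all
  interpret \<Omega>: prob_space \<Omega> by fact
  have int: "integrable \<Omega> (\<lambda>\<omega>. h n (Z \<omega>))" if [measurable]: "Z \<in> borel_measurable \<Omega>" for n Z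
    using bound by (intro integrable_bounded_borel[OF \<Omega>.finite_measure_axioms]) auto
  have eq: "(LINT y|scaled_law (t n). h n y) - ((LINT y|\<kappa>. h n y) + A / 2 * h n 0) =
      (c n - c') * (LINT \<omega>|\<Omega>. h n (Ys n \<omega>)) + c' * (LINT \<omega>|\<Omega>. h n (Ys n \<omega>) - h n (Y \<omega>))" for n
  proof -
    have "(LINT y|R n. h n y) = (LINT \<omega>|\<Omega>. h n (Ys n \<omega>))"
      unfolding dYs[symmetric] by (rule integral_distr) auto
    moreover have "(LINT y|R'. h n y) = (LINT \<omega>|\<Omega>. h n (Y \<omega>))"
      unfolding dY[symmetric] by (rule integral_distr) auto
    moreover have "c n * (LINT y|R n. h n y) = (LINT y|scaled_law (t n). h n y) + 1 * h n 0"
      unfolding c_def R_def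
      by (rule integral_atom_mixture[OF finite_measure_scaled_law[OF t(2)] sets_scaled_law[OF t(2)]
            zero_less_one h bound])
    moreover have "c' * (LINT y|R'. h n y) = (LINT y|\<kappa>. h n y) + (A / 2 + 1) * h n 0"
      unfolding c'_def R'_def
      by (rule integral_atom_mixture[OF finite_measure_kappa sets_kappa A h bound])
    ultimately show ?thesis
      using int by (simp add: algebra_simps)
  qed
  have "(\<lambda>n. (c n - c') * (LINT \<omega>|\<Omega>. h n (Ys n \<omega>))) \<longlonglongrightarrow> 0"
  proof (rule null_times_bounded)
    have "(\<lambda>n. c n) \<longlonglongrightarrow> A / 2 + measure \<kappa> UNIV + 1"
      unfolding c_def by (intro tendsto_add tendsto_const scaled_law_mass_tendsto t)
    thus "(\<lambda>n. c n - c') \<longlonglongrightarrow> 0"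
      by (simp add: c'_def LIM_zero_iff add_ac)
    fix n
    have "\<bar>LINT \<omega>|\<Omega>. h n (Ys n \<omega>)\<bar> \<le> (LINT \<omega>|\<Omega>. B)"
      using bound int[OF Ys, of n]
      by (intro order_trans[OF integral_abs_bound] integral_mono integrable_abs) auto
    thus "\<bar>LINT \<omega>|\<Omega>. h n (Ys n \<omega>)\<bar> \<le> B"
      by (simp add: \<Omega>.prob_space)
  qed
  moreover have "(\<lambda>n. LINT \<omega>|\<Omega>. h n (Ys n \<omega>) - h n (Y \<omega>)) \<longlonglongrightarrow> (LINT \<omega>|\<Omega>. 0)"
  proof (rule integral_dominated_convergence[where w = "\<lambda>_. 2 * B"])
    show "AE \<omega> in \<Omega>. (\<lambda>n. h n (Ys n \<omega>) - h n (Y \<omega>)) \<longlonglongrightarrow> 0"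
      using lim equi by auto
    show "AE \<omega> in \<Omega>. norm (h n (Ys n \<omega>) - h n (Y \<omega>)) \<le> 2 * B" for n
    proof (rule AE_I2)
      fix \<omega>
      show "norm (h n (Ys n \<omega>) - h n (Y \<omega>)) \<le> 2 * B"
        using bound[of n "Ys n \<omega>"] bound[of n "Y \<omega>"] by simp
    qed
  qed auto
  hence "(\<lambda>n. c' * (LINT \<omega>|\<Omega>. h n (Ys n \<omega>) - h n (Y \<omega>))) \<longlonglongrightarrow> 0"
    by (simp add: tendsto_mult_right_zero)
  ultimately show ?thesis
    unfolding eq by (rule tendsto_add_zero)
qed

text \<open>
  Since the mean of \<open>sin X\<^sub>t\<close> is the imaginary part of \<open>exp (- t * \<psi> 1)\<close>, this is its derivative at
  \<open>t = 0\<close>; it replaces \<open>\<gamma>\<close> when jumps are compensated by \<open>sin y\<close>.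
\<close>

definition drift :: real where
  "drift = - Im (\<psi> 1)"

lemma sin_mean_tendsto:
  assumes t: "t \<longlonglongrightarrow> 0" "\<And>n. 0 < t n"
  shows "(\<lambda>n. (LINT y|P (t n). sin y) / t n) \<longlonglongrightarrow> drift"
proof -
  have eq: "Im ((exp (- complex_of_real (t n) * \<psi> 1) - exp (- complex_of_real (t n) * 0)) / complex_of_real (t n))
      = (LINT y|P (t n). sin y) / t n" for n
  proof -
    interpret Pt: real_distribution "P (t n)"
      using t(2)[of n] by (intro real_distribution_P) simp
    have "exp (- complex_of_real (t n) * \<psi> 1) = char (P (t n)) 1"
      using t(2)[of n] by (simp add: char_P)
    also have "\<dots> = Complex (LINT y|P (t n). cos (1 * y)) (LINT y|P (t n). sin (1 * y))"
      unfolding char_def by (rule integral_iexp_eq_Complex[OF Pt.finite_measure_axioms Pt.events_eq_borel])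
    finally show ?thesis by (simp add: Im_divide_of_real)
  qed
  have "(\<lambda>n. Im ((exp (- complex_of_real (t n) * \<psi> 1) - exp (- complex_of_real (t n) * 0)) / complex_of_real (t n)))
      \<longlonglongrightarrow> Im (0 - \<psi> 1)"
    by (intro tendsto_Im exp_diff_quotient_tendsto t)
  thus ?thesis unfolding eq by (simp add: drift_def)
qed

text \<open>
  The Levy--Ito form of the generator, with compensator \<open>sin y\<close> and the integral against \<open>\<mu>\<close> written
  as an integral against the finite measure \<open>\<kappa>\<close>.
\<close>

definition levy_generator :: "(real \<Rightarrow> real) \<Rightarrow> real \<Rightarrow> real" where
  "levy_generator f x = drift * deriv f x + A / 2 * deriv (deriv f) x + (LINT y|\<kappa>. levy_quotient f x y)"

lemma levy_generator_C0:
  assumes f: "f \<in> C0_2"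
  shows "levy_generator f \<in> C0"
proof -
  obtain B where "\<And>x y. \<bar>levy_quotient f x y\<bar> \<le> B" by (rule levy_quotient_bounded[OF f]) (rule that)
  moreover have "levy_quotient f x \<in> borel_measurable \<kappa>" for x
    using levy_quotient_measurable[OF C0_2_D(1)[OF f]] by simp
  ultimately have "(\<lambda>x. LINT y|\<kappa>. levy_quotient f x y) \<in> C0"
    by (intro C0_integral[OF finite_measure_kappa levy_quotient_C0[OF f]])
  thus ?thesis
    unfolding levy_generator_def[abs_def] by (intro C0_add C0_cmult C0_2_D(2,3)[OF f])
qed

lemma difference_quotient_eq:
  assumes f: "f \<in> C0_2" and t: "0 < t"
  shows "((LINT y|P t. f (x + y)) - f x) / t =
    (LINT y|scaled_law t. levy_quotient f x y) + deriv f x * ((LINT y|P t. sin y) / t)"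
proof -
  interpret Pt: real_distribution "P t" using t by (intro real_distribution_P) simp
  have [simp]: "measure (P t) UNIV = 1" using Pt.prob_space by simp
  note [measurable] = C0_measurable[OF C0_2_D(1)[OF f]] levy_quotient_measurable[OF C0_2_D(1)[OF f]]
  obtain B where B: "\<And>x. \<bar>f x\<bar> \<le> B" using C0_bounded[OF C0_2_D(1)[OF f]] by metis
  have int: "integrable (P t) (\<lambda>y. f (x + y))"
    using B by (intro integrable_bounded_borel[OF Pt.finite_measure_axioms, where C = B]) auto
  have int': "integrable (P t) (\<lambda>y. sin y)"
    by (rule integrable_bounded_borel[OF Pt.finite_measure_axioms, where C = 1]) auto
  have "(LINT y|scaled_law t. levy_quotient f x y) =
      (LINT y|P t. (f (x + y) - f x - deriv f x * sin y) / t)"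
    unfolding levy_quotient_times_weight[symmetric]
    using t by (subst integral_scaled_law) (auto simp: mult.commute)
  also have "\<dots> = (LINT y|P t. f (x + y) - f x - deriv f x * sin y) / t"
    by (rule integral_divide_zero)
  also have "(LINT y|P t. f (x + y) - f x - deriv f x * sin y) =
      (LINT y|P t. f (x + y)) - f x - deriv f x * (LINT y|P t. sin y)"
    using int int' by simp
  finally show ?thesis by (simp add: diff_divide_distrib)
qed

text \<open>
  The error of the difference quotient at time \<open>t n\<close> and point \<open>X n\<close> splits into the error of the drift
  and the difference between the integrals of \<open>levy_quotient f (X n)\<close> against the scaled law and its
  weak limit. The atom \<open>A / 2\<close> of that limit produces the term \<open>A / 2 \<cdot> f''\<close>.
\<close>

theorem generates_levy_generator:
  assumes f: "f \<in> C0_2"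
    and T: "\<And>t x. 0 < t \<Longrightarrow> T t f x = (LINT y|P t. f (x + y))"
  shows "generates T f (levy_generator f)"
    and "generator T f = levy_generator f"
proof -
  obtain B where B: "\<And>x. \<bar>f x\<bar> \<le> B" using C0_bounded[OF C0_2_D(1)[OF f]] by metis
  obtain B1 where B1: "\<And>x. \<bar>deriv f x\<bar> \<le> B1" using C0_bounded[OF C0_2_D(2)[OF f]] by metis
  have bd: "\<exists>B. \<forall>x. \<bar>T t f x\<bar> \<le> B" if t: "0 < t" for t
  proof (intro exI allI)
    fix x
    interpret Pt: real_distribution "P t" using t by (intro real_distribution_P) simp
    have [simp]: "measure (P t) UNIV = 1" using Pt.prob_space by simp
    note [measurable] = C0_measurable[OF C0_2_D(1)[OF f]]
    have "integrable (P t) (\<lambda>y. f (x + y))"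
      using B by (intro integrable_bounded_borel[OF Pt.finite_measure_axioms, where C = B]) auto
    hence "\<bar>LINT y|P t. f (x + y)\<bar> \<le> (LINT y|P t. B)"
      using B by (intro order_trans[OF integral_abs_bound] integral_mono integrable_abs) auto
    thus "\<bar>T t f x\<bar> \<le> B" using T[OF t] by simp
  qed
  show *: "generates T f (levy_generator f)"
  proof (rule generatesI_sequentially[where T = T, OF C0_2_D(1)[OF f] levy_generator_C0[OF f] bd])
    fix t :: "nat \<Rightarrow> real" and X :: "nat \<Rightarrow> real"
    assume t: "t \<longlonglongrightarrow> 0" "\<And>n. 0 < t n"
    obtain Bq where Bq: "\<And>x y. \<bar>levy_quotient f x y\<bar> \<le> Bq" by (rule levy_quotient_bounded[OF f]) (rule that)
    have 1: "(\<lambda>n. (LINT y|scaled_law (t n). levy_quotient f (X n) y) -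
        ((LINT y|\<kappa>. levy_quotient f (X n) y) + A / 2 * levy_quotient f (X n) 0)) \<longlonglongrightarrow> 0"
      by (rule scaled_law_integral_tendsto[OF t levy_quotient_measurable[OF C0_2_D(1)[OF f]] Bq])
        (rule levy_quotient_equicontinuous[OF f])
    have 2: "(\<lambda>n. ((LINT y|P (t n). sin y) / t n - drift) * deriv f (X n)) \<longlonglongrightarrow> 0"
      using sin_mean_tendsto[OF t] B1 by (intro null_times_bounded) (auto simp: LIM_zero_iff)
    have "(T (t n) f (X n) - f (X n)) / t n - levy_generator f (X n) =
        ((LINT y|scaled_law (t n). levy_quotient f (X n) y) -
          ((LINT y|\<kappa>. levy_quotient f (X n) y) + A / 2 * levy_quotient f (X n) 0)) +
        ((LINT y|P (t n). sin y) / t n - drift) * deriv f (X n)" for n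
      unfolding T[OF t(2)] difference_quotient_eq[OF f t(2)]
      by (simp add: levy_generator_def levy_quotient_at_0 algebra_simps)
    with tendsto_add_zero[OF 1 2]
    show "(\<lambda>n. (T (t n) f (X n) - f (X n)) / t n - levy_generator f (X n)) \<longlonglongrightarrow> 0" by simp
  qed
  show "generator T f = levy_generator f"
    unfolding generator_def using * by (intro the_equality generates_unique[where T = T, OF bd]) auto
qed

end

section \<open>The second-order kernel of a single jump\<close>

text \<open>
  For compactly supported \<open>f\<close> the function \<open>f''\<close> is orthogonal to affine functions, so many kernels
  represent \<open>f (x + y) - f x - f' x * sin y\<close> as an integral of \<open>f'' (x + u)\<close> over \<open>u\<close>. This one is
  supported on the side of the origin to which the jump goes. It is therefore bounded on
  bounded sets of \<open>u\<close>, uniformly in \<open>y\<close>, whereas the kernel with remainder \<open>y - u\<close> from Taylor's formula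
  grows with \<open>y\<close> and need not be integrable against \<open>\<mu>\<close>.
\<close>

definition jump_kernel :: "real \<Rightarrow> real \<Rightarrow> real" where
  "jump_kernel y u = (if 0 < y * u then sin \<bar>y\<bar> - min \<bar>u\<bar> \<bar>y\<bar> else 0)"

lemma jump_kernel_measurable [measurable (raw)]:
  assumes [measurable]: "f \<in> borel_measurable M" "g \<in> borel_measurable M"
  shows "(\<lambda>p. jump_kernel (f p) (g p)) \<in> borel_measurable M"
  unfolding jump_kernel_def by measurable

lemma compact_support_derivative_eq_0:
  fixes f f1 :: "real \<Rightarrow> real"
  assumes f: "\<And>x. (f has_real_derivative f1 x) (at x)" and z: "\<forall>x. a < \<bar>x\<bar> \<longrightarrow> f x = 0"
  shows "\<forall>x. a < \<bar>x\<bar> \<longrightarrow> f1 x = 0"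
proof (intro allI impI)
  fix x assume x: "a < \<bar>x\<bar>"
  have "open {x::real. a < \<bar>x\<bar>}"
    by (intro open_Collect_less continuous_intros)
  hence "((\<lambda>_. 0) has_real_derivative f1 x) (at x)"
    by (rule has_field_derivative_transform_within_open[OF f]) (use x z in auto)
  thus "f1 x = 0" using DERIV_unique[OF _ DERIV_const] by blast
qed

lemma DERIV_translate:
  fixes f f' :: "real \<Rightarrow> real"
  assumes "\<And>x. (f has_real_derivative f' x) (at x)"
  shows "((\<lambda>u. f (x + u)) has_real_derivative f' (x + u)) (at u)"
  using assms[of "u + x"] by (simp add: DERIV_shift add.commute)

lemma DERIV_reflect:
  fixes f f' :: "real \<Rightarrow> real"
  assumes "\<And>x. (f has_real_derivative f' x) (at x)"
  shows "((\<lambda>x. f (- x)) has_real_derivative - f' (- x)) (at x)"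
  using assms[of "- x"] by (simp add: DERIV_mirror)

text \<open>
  On \<open>{0..y}\<close> the integrand is the derivative of \<open>(sin y - u) * f' (x + u) + f (x + u)\<close>, and on \<open>{y..}\<close>
  that of \<open>(sin y - y) * f' (x + u)\<close>, which vanishes for large \<open>u\<close>.
\<close>

lemma jump_kernel_represents_pos:
  fixes f f1 f2 :: "real \<Rightarrow> real"
  assumes f: "\<And>x. (f has_real_derivative f1 x) (at x)" "\<And>x. (f1 has_real_derivative f2 x) (at x)"
    and cont: "\<And>x. isCont f2 x" and z: "\<forall>x. a < \<bar>x\<bar> \<longrightarrow> f x = 0" and y: "0 < y"
  shows "(LINT u|lborel. jump_kernel y u * f2 (x + u)) = f (x + y) - f x - f1 x * sin y"
proof -
  note z1 = compact_support_derivative_eq_0[OF f(1) z]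
  note z2 = compact_support_derivative_eq_0[OF f(2) z1]
  \<comment> \<open>\<open>f (x + u)\<close> and its derivatives vanish for \<open>u \<ge> R\<close>\<close>
  define R where "R = y + \<bar>a\<bar> + \<bar>x\<bar> + 1"
  have R: "y \<le> R" "f1 (x + R) = 0" using y by (auto simp: R_def intro!: z1[rule_format])
  define g1 where "g1 = (\<lambda>u. (sin y - u) * f2 (x + u))"
  define g2 where "g2 = (\<lambda>u. (sin y - y) * f2 (x + u))"
  have cont': "isCont (\<lambda>u. f2 (x + u)) u" for u
    by (intro isCont_o2[of _ "\<lambda>u. x + u" f2] cont) simp
  have f': "((\<lambda>u. f (x + u)) has_real_derivative f1 (x + u)) (at u)"
    "((\<lambda>u. f1 (x + u)) has_real_derivative f2 (x + u)) (at u)" for u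
    using DERIV_translate[OF f(1)] DERIV_translate[OF f(2)] by blast+
  have 1: "has_bochner_integral lborel (\<lambda>u. g1 u * indicator {0..y} u)
      (((sin y - y) * f1 (x + y) + f (x + y)) - ((sin y - 0) * f1 (x + 0) + f (x + 0)))"
    using y
    by (intro has_bochner_integral_FTC_Icc_real[where F = "\<lambda>u. (sin y - u) * f1 (x + u) + f (x + u)"])
      (auto simp: g1_def intro!: derivative_eq_intros f' continuous_intros cont')
  have 2: "has_bochner_integral lborel (\<lambda>u. g2 u * indicator {y..R} u)
      ((sin y - y) * f1 (x + R) - (sin y - y) * f1 (x + y))"
    using R(1)
    by (intro has_bochner_integral_FTC_Icc_real[where F = "\<lambda>u. (sin y - y) * f1 (x + u)"])
      (auto simp: g2_def intro!: derivative_eq_intros f' continuous_intros cont')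
  have f2m: "f2 \<in> borel_measurable borel"
    using cont by (intro borel_measurable_continuous_onI) (simp add: continuous_on_eq_continuous_at)
  have "(LINT u|lborel. jump_kernel y u * f2 (x + u)) =
      (LINT u|lborel. g1 u * indicator {0..y} u + g2 u * indicator {y..R} u)"
  proof (rule integral_cong_AE)
    have "AE u in lborel. u \<noteq> 0 \<and> u \<noteq> y"
      using AE_lborel_singleton by (intro AE_conjI) auto
    thus "AE u in lborel. jump_kernel y u * f2 (x + u) =
        g1 u * indicator {0..y} u + g2 u * indicator {y..R} u"
    proof eventually_elim
      case (elim u)
      have "f2 (x + u) = 0" if "R < u"
        by (rule z2[rule_format]) (use that y in \<open>auto simp: R_def\<close>)
      thus ?case
        using elim y R(1)
        by (auto simp: jump_kernel_def g1_def g2_def indicator_def zero_less_mult_iff min_def)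
    qed
  qed (use f2m in \<open>simp_all add: g1_def g2_def\<close>)
  also have "\<dots> = f (x + y) - f x - f1 x * sin y"
    using has_bochner_integral_integral_eq[OF has_bochner_integral_add[OF 1 2]] R(2)
    by (simp add: algebra_simps)
  finally show ?thesis .
qed

lemma jump_kernel_uminus: "jump_kernel (- y) u = jump_kernel y (- u)"
  by (simp add: jump_kernel_def)

lemma jump_kernel_represents:
  fixes f f1 f2 :: "real \<Rightarrow> real"
  assumes f: "\<And>x. (f has_real_derivative f1 x) (at x)" "\<And>x. (f1 has_real_derivative f2 x) (at x)"
    and cont: "\<And>x. isCont f2 x" and z: "\<forall>x. a < \<bar>x\<bar> \<longrightarrow> f x = 0"
  shows "(LINT u|lborel. jump_kernel y u * f2 (x + u)) = f (x + y) - f x - f1 x * sin y"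
proof (cases y "0 :: real" rule: linorder_cases)
  case greater
  show ?thesis by (rule jump_kernel_represents_pos[OF f cont z greater])
next
  case equal
  thus ?thesis by (simp add: jump_kernel_def)
next
  case less
  \<comment> \<open>reflection \<open>x \<mapsto> - x\<close> turns a negative jump into a positive one\<close>
  have "(LINT u|lborel. jump_kernel y u * f2 (x + u)) =
      (LINT u|lborel. jump_kernel (- y) u * f2 (- (- x + u)))"
    by (subst lborel_integral_real_affine[of "- 1" _ 0]) (simp_all add: jump_kernel_uminus)
  also have "\<dots> = f (- (- x + - y)) - f (- (- x)) - - f1 (- (- x)) * sin (- y)"
  proof (rule jump_kernel_represents_pos[where f = "\<lambda>x. f (- x)" and ?f1.0 = "\<lambda>x. - f1 (- x)"
        and ?f2.0 = "\<lambda>x. f2 (- x)" and a = a])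
    show "((\<lambda>x. f (- x)) has_real_derivative - f1 (- x)) (at x)" for x
      by (rule DERIV_reflect[OF f(1)])
    show "((\<lambda>x. - f1 (- x)) has_real_derivative f2 (- x)) (at x)" for x
      using DERIV_minus[OF DERIV_reflect[OF f(2)]] by simp
    show "isCont (\<lambda>x. f2 (- x)) x" for x
      by (intro isCont_o2[of _ uminus f2] cont) simp
  qed (use z less in auto)
  finally show ?thesis by (simp add: add.commute)
qed

text \<open>
  This bound and the next one serve small and large jumps: the first is \<open>O(y\<^sup>2)\<close> after integration over \<open>u\<close>,
  since the interval has length \<open>2 * \<bar>y\<bar>\<close>; the second is uniform in \<open>y\<close>. Together they control the
  integral over \<open>u\<close> by the weight.
\<close>

lemma abs_jump_kernel_le: "\<bar>jump_kernel y u\<bar> \<le> y\<^sup>2 + \<bar>y\<bar> * indicator {-\<bar>y\<bar>..\<bar>y\<bar>} u"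
proof -
  have "\<bar>sin \<bar>y\<bar> - \<bar>y\<bar>\<bar> \<le> y\<^sup>2"
    using abs_diff_sin_le[of "\<bar>y\<bar>"] by (simp add: abs_minus_commute)
  hence "\<bar>u\<bar> \<le> \<bar>y\<bar> \<Longrightarrow> \<bar>sin \<bar>y\<bar> - \<bar>u\<bar>\<bar> \<le> y\<^sup>2 + \<bar>y\<bar>"
    by linarith
  moreover have "u \<in> {-\<bar>y\<bar>..\<bar>y\<bar>} \<longleftrightarrow> \<bar>u\<bar> \<le> \<bar>y\<bar>" by auto
  ultimately show ?thesis
    using \<open>\<bar>sin \<bar>y\<bar> - \<bar>y\<bar>\<bar> \<le> y\<^sup>2\<close>
    by (simp add: jump_kernel_def indicator_def min_def)
qed

lemma abs_jump_kernel_le': "\<bar>jump_kernel y u\<bar> \<le> 1 + \<bar>u\<bar>"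
  using abs_sin_le_one[of "\<bar>y\<bar>"] by (auto simp: jump_kernel_def min_def simp del: abs_sin_le_one)

lemma jump_kernel_bounded_support:
  fixes \<phi> :: "real \<Rightarrow> real"
  assumes m [measurable]: "\<phi> \<in> borel_measurable borel" and M: "\<And>u. \<bar>\<phi> u\<bar> \<le> M"
    and supp: "\<forall>u. a < \<bar>u\<bar> \<longrightarrow> \<phi> u = 0" and a: "0 \<le> a"
  shows "integrable lborel (\<lambda>u. jump_kernel y u * \<phi> u)"
    and "(LINT u|lborel. \<bar>jump_kernel y u * \<phi> u\<bar>) \<le> 6 * M * (1 + a)\<^sup>2 * gauss_weight y"
proof -
  have M0: "0 \<le> M" using M[of 0] by linarith
  have ind: "integrable lborel (\<lambda>u. c * indicator {-b..b} u :: real)" for b c :: real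
    by (intro integrable_mult_right integrable_real_indicator) (auto simp: emeasure_lborel_Icc_eq)
  have int_ind: "(LINT u|lborel. c * indicator {-b..b} u) = c * (2 * b)" if "0 \<le> b" for b c :: real
    using that by simp
  have le1: "\<bar>jump_kernel y u * \<phi> u\<bar> \<le> (1 + a) * M * indicator {-a..a} u" for u
  proof (cases "a < \<bar>u\<bar>")
    case False
    hence "\<bar>jump_kernel y u * \<phi> u\<bar> \<le> (1 + a) * M"
      unfolding abs_mult using M a by (intro mult_mono order_trans[OF abs_jump_kernel_le']) auto
    thus ?thesis using False by (auto simp: indicator_def)
  qed (use supp M0 a in \<open>simp add: indicator_def\<close>)
  have le2: "\<bar>jump_kernel y u * \<phi> u\<bar> \<le> (M * y\<^sup>2) * indicator {-a..a} u + (M * \<bar>y\<bar>) * indicator {-\<bar>y\<bar>..\<bar>y\<bar>} u" for u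
  proof (cases "a < \<bar>u\<bar>")
    case False
    have "\<bar>jump_kernel y u * \<phi> u\<bar> \<le> (y\<^sup>2 + \<bar>y\<bar> * indicator {-\<bar>y\<bar>..\<bar>y\<bar>} u) * M"
      unfolding abs_mult using M by (intro mult_mono abs_jump_kernel_le) auto
    thus ?thesis using False by (auto simp: indicator_def algebra_simps)
  qed (use supp M0 in simp)
  show int: "integrable lborel (\<lambda>u. jump_kernel y u * \<phi> u)"
    by (rule Bochner_Integration.integrable_bound[OF ind[of "(1 + a) * M" a]])
      (use le1 in \<open>auto intro: order_trans[OF _ abs_ge_self]\<close>)
  have "(LINT u|lborel. \<bar>jump_kernel y u * \<phi> u\<bar>) \<le> (LINT u|lborel. (1 + a) * M * indicator {-a..a} u)"
    using int ind le1 by (intro integral_mono integrable_abs) auto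
  also have "\<dots> = M * ((1 + a) * (2 * a))" using int_ind[OF a] by simp
  also have "\<dots> \<le> M * (2 * (1 + a)\<^sup>2)"
    using a M0 by (intro mult_left_mono) (auto simp: power2_eq_square algebra_simps)
  finally have 1: "(LINT u|lborel. \<bar>jump_kernel y u * \<phi> u\<bar>) \<le> 2 * M * (1 + a)\<^sup>2" by simp
  have "(LINT u|lborel. \<bar>jump_kernel y u * \<phi> u\<bar>) \<le>
      (LINT u|lborel. (M * y\<^sup>2) * indicator {-a..a} u + (M * \<bar>y\<bar>) * indicator {-\<bar>y\<bar>..\<bar>y\<bar>} u)"
    using int ind le2 by (intro integral_mono integrable_abs Bochner_Integration.integrable_add) auto
  also have "\<dots> = (M * y\<^sup>2) * (2 * a) + (M * \<bar>y\<bar>) * (2 * \<bar>y\<bar>)"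
    by (subst Bochner_Integration.integral_add[OF ind ind], subst int_ind[OF a],
        subst int_ind[OF abs_ge_zero]) (rule refl)
  also have "\<dots> = M * y\<^sup>2 * (2 * (1 + a))"
    by (simp add: power2_eq_square algebra_simps)
  also have "\<dots> \<le> M * y\<^sup>2 * (2 * (1 + a)\<^sup>2)"
    using a M0 by (intro mult_left_mono) (auto simp: power2_eq_square algebra_simps)
  finally have 2: "(LINT u|lborel. \<bar>jump_kernel y u * \<phi> u\<bar>) \<le> 2 * M * (1 + a)\<^sup>2 * y\<^sup>2"
    by (simp add: mult_ac)
  have "(LINT u|lborel. \<bar>jump_kernel y u * \<phi> u\<bar>) \<le> 3 * (2 * M * (1 + a)\<^sup>2) * gauss_weight y"
    using M0 by (intro dominated_by_gauss_weight 1 2) auto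
  thus "(LINT u|lborel. \<bar>jump_kernel y u * \<phi> u\<bar>) \<le> 6 * M * (1 + a)\<^sup>2 * gauss_weight y" by simp
qed

section \<open>Convolution with a locally integrable function\<close>

lemma integrable_times_bounded_support:
  fixes k \<phi> :: "real \<Rightarrow> real"
  assumes k: "set_integrable lborel {-R..R} k" and m [measurable]: "\<phi> \<in> borel_measurable borel"
    and M: "\<And>u. \<bar>\<phi> u\<bar> \<le> M" and supp: "\<forall>u. R < \<bar>u\<bar> \<longrightarrow> \<phi> u = 0"
  shows "integrable lborel (\<lambda>u. k u * \<phi> u)"
proof -
  have k': "integrable lborel (\<lambda>u. indicator {-R..R} u * k u)"
    using k by (simp add: set_integrable_def)
  have eq: "k u * \<phi> u = indicator {-R..R} u * k u * \<phi> u" for u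
  proof (cases "R < \<bar>u\<bar>")
    case False
    hence "u \<in> {-R..R}" by auto
    thus ?thesis by simp
  qed (use supp in simp)
  show ?thesis
    unfolding eq
  proof (rule Bochner_Integration.integrable_bound[OF integrable_mult_left[OF k', of M]])
    show "(\<lambda>u. indicator {-R..R} u * k u * \<phi> u) \<in> borel_measurable lborel"
      using borel_measurable_integrable[OF k'] by measurable
    show "AE u in lborel. norm (indicator {-R..R} u * k u * \<phi> u) \<le> norm (indicator {-R..R} u * k u * M)"
      using M by (auto simp: abs_mult intro!: mult_left_mono order_trans[OF M abs_ge_self])
  qed
qed

text \<open>
  All difference quotients of \<open>g\<close> with steps in a bounded set share a bounded support and the bound
  of \<open>g'\<close>, so the derivative passes under the integral sign by dominated convergence.
\<close>

lemma has_derivative_locally_integrable_convolution: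
  fixes k g g' :: "real \<Rightarrow> real"
  assumes k: "\<And>R. 0 < R \<Longrightarrow> set_integrable lborel {-R..R} k"
    and g: "\<And>x. (g has_real_derivative g' x) (at x)"
    and B: "\<And>x. \<bar>g' x\<bar> \<le> B" and m [measurable]: "g' \<in> borel_measurable borel"
    and supp: "\<forall>x. a < \<bar>x\<bar> \<longrightarrow> g x = 0"
  shows "((\<lambda>x. LINT u|lborel. k u * g (x + u)) has_real_derivative
    (LINT u|lborel. k u * g' (x + u))) (at x)"
proof -
  have lip: "\<bar>g p - g q\<bar> \<le> B * \<bar>p - q\<bar>" for p q
    using field_differentiable_bound[of UNIV g g' B p q] g B by auto
  have gm [measurable]: "g \<in> borel_measurable borel"
    using g by (intro borel_measurable_continuous_onI) (auto simp: continuous_on_eq_continuous_at intro: DERIV_isCont)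
  have "\<bar>a\<bar> + 1 > a" by linarith
  hence gB: "\<bar>g p\<bar> \<le> B * (2 * \<bar>a\<bar> + 2)" for p
  proof (cases "a < \<bar>p\<bar>")
    case True
    thus ?thesis using supp B[of 0] by simp
  next
    case False
    have "g (\<bar>a\<bar> + 1) = 0" by (rule supp[rule_format]) simp
    hence "\<bar>g p\<bar> \<le> B * \<bar>p - (\<bar>a\<bar> + 1)\<bar>" using lip[of p "\<bar>a\<bar> + 1"] by simp
    also have "\<dots> \<le> B * (2 * \<bar>a\<bar> + 2)"
      using False B[of 0] by (intro mult_left_mono) auto
    finally show ?thesis .
  qed
  have int: "integrable lborel (\<lambda>u. k u * g (p + u))" for p
    by (rule integrable_times_bounded_support[OF k[of "\<bar>a\<bar> + \<bar>p\<bar> + 1"]])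
      (use gB in \<open>auto intro!: supp[rule_format]\<close>)
  have "((\<lambda>h. ((LINT u|lborel. k u * g (x + h + u)) - (LINT u|lborel. k u * g (x + u))) / h)
      \<longlongrightarrow> (LINT u|lborel. k u * g' (x + u))) (at 0)"
    unfolding tendsto_at_iff_sequentially
  proof (intro allI impI)
    fix h :: "nat \<Rightarrow> real" assume h0: "\<forall>i. h i \<in> UNIV - {0}" and h: "h \<longlonglongrightarrow> 0"
    obtain H where H: "0 < H" "\<And>n. \<bar>h n\<bar> \<le> H"
      using convergent_imp_Bseq[OF convergentI[OF h]] by (auto simp: Bseq_def)
    define R where "R = \<bar>a\<bar> + \<bar>x\<bar> + H + 1"
    define s where "s = (\<lambda>n u. k u * ((g (x + h n + u) - g (x + u)) / h n))"
    have R: "0 < R" using H by (simp add: R_def)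
    have supp_s: "g (x + h n + u) = 0" "g (x + u) = 0" if "R < \<bar>u\<bar>" for n u
      using that H(2)[of n] H(1) by (auto intro!: supp[rule_format] simp: R_def)
    have bd: "\<bar>(g (x + h n + u) - g (x + u)) / h n\<bar> \<le> B" for n u
      using lip[of "x + h n + u" "x + u"] h0 by (simp add: field_simps)
    have int_s: "integrable lborel (s n)" for n
      unfolding s_def by (rule integrable_times_bounded_support[OF k[OF R] _ bd]) (use supp_s in auto)
    have g'0: "g' (x + u) = 0" if "R < \<bar>u\<bar>" for u
      by (rule compact_support_derivative_eq_0[OF g supp, rule_format]) (use that H(1) in \<open>auto simp: R_def\<close>)
    have int_lim: "integrable lborel (\<lambda>u. k u * g' (x + u))"
      by (rule integrable_times_bounded_support[OF k[OF R] _ B]) (use g'0 in auto)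
    have "(\<lambda>n. LINT u|lborel. s n u) \<longlonglongrightarrow> (LINT u|lborel. k u * g' (x + u))"
    proof (rule integral_dominated_convergence)
      show "integrable lborel (\<lambda>u. \<bar>k u * (B * indicator {-R..R} u)\<bar>)"
        by (intro integrable_abs integrable_times_bounded_support[OF k[OF R], of _ "\<bar>B\<bar>"])
          (auto simp: indicator_def)
      show "AE u in lborel. (\<lambda>n. s n u) \<longlonglongrightarrow> k u * g' (x + u)"
      proof (rule AE_I2)
        fix u
        have "((\<lambda>h. (g (x + u + h) - g (x + u)) / h) \<longlongrightarrow> g' (x + u)) (at 0)"
          using g[of "x + u"] by (simp add: DERIV_def)
        moreover have "filterlim h (at 0) sequentially"
          using h h0 by (auto simp: filterlim_at)
        ultimately have "(\<lambda>n. (g (x + u + h n) - g (x + u)) / h n) \<longlonglongrightarrow> g' (x + u)"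
          by (rule filterlim_compose)
        thus "(\<lambda>n. s n u) \<longlonglongrightarrow> k u * g' (x + u)"
          unfolding s_def by (intro tendsto_mult tendsto_const) (simp add: add_ac)
      qed
      show "AE u in lborel. norm (s n u) \<le> \<bar>k u * (B * indicator {-R..R} u)\<bar>" for n
      proof (rule AE_I2)
        fix u
        show "norm (s n u) \<le> \<bar>k u * (B * indicator {-R..R} u)\<bar>"
        proof (cases "R < \<bar>u\<bar>")
          case True
          thus ?thesis by (simp add: s_def supp_s)
        next
          case False
          hence "u \<in> {-R..R}" by auto
          have "norm (s n u) \<le> \<bar>k u\<bar> * B"
            unfolding s_def real_norm_def abs_mult[of "k u"] by (intro mult_left_mono bd) simp
          also have "\<dots> \<le> \<bar>k u * (B * indicator {-R..R} u)\<bar>"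
            using \<open>u \<in> {-R..R}\<close> by (simp add: abs_mult mult_left_mono)
          finally show ?thesis .
        qed
      qed
    qed (use int_s int_lim in auto)
    moreover have "(LINT u|lborel. s n u) =
        ((LINT u|lborel. k u * g (x + h n + u)) - (LINT u|lborel. k u * g (x + u))) / h n" for n
    proof -
      have "s n = (\<lambda>u. (k u * g (x + h n + u) - k u * g (x + u)) / h n)"
        by (simp add: s_def fun_eq_iff right_diff_distrib)
      thus ?thesis using int by simp
    qed
    ultimately show "((\<lambda>h. ((LINT u|lborel. k u * g (x + h + u)) - (LINT u|lborel. k u * g (x + u))) / h) \<circ> h)
        \<longlonglongrightarrow> (LINT u|lborel. k u * g' (x + u))"
      by (simp add: comp_def)
  qed
  thus ?thesis by (simp add: DERIV_def)
qed

section \<open>The convolution kernel\<close>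

context levy_khinchine_laws begin

text \<open>
  The integral is that of \<open>jump_kernel y u\<close> against \<open>\<mu>\<close>; by Fubini it exists for almost every \<open>u\<close>. The
  step function represents the drift, as \<open>f' x\<close> is minus the integral of \<open>f''\<close> over the half-line from \<open>x\<close>.
\<close>

definition conv_kernel :: "real \<Rightarrow> real" where
  "conv_kernel u = (LINT y|\<kappa>. jump_kernel y u / gauss_weight y) - drift * indicator {0<..} u"

text \<open>
  One statement serves twice: with \<open>\<phi>\<close> the indicator of an interval it yields local integrability of
  the kernel, with \<open>\<phi> u = f'' (x + u)\<close> the exchange of integrals.
\<close>

lemma jump_kernel_pair_integrable:
  fixes \<phi> :: "real \<Rightarrow> real"
  assumes m [measurable]: "\<phi> \<in> borel_measurable borel" and M: "\<And>u. \<bar>\<phi> u\<bar> \<le> M"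
    and supp: "\<forall>u. a < \<bar>u\<bar> \<longrightarrow> \<phi> u = 0" and a: "0 \<le> a"
  shows "integrable (\<kappa> \<Otimes>\<^sub>M lborel) (\<lambda>(y, u). jump_kernel y u / gauss_weight y * \<phi> u)"
proof -
  interpret KL: pair_sigma_finite \<kappa> "lborel :: real measure" ..
  note * = jump_kernel_bounded_support[OF assms]
  define C where "C = 6 * M * (1 + a)\<^sup>2"
  have "0 \<le> M" using M[of 0] by linarith
  hence C: "0 \<le> C" by (simp add: C_def)
  have eq: "jump_kernel y u / gauss_weight y * \<phi> u = (jump_kernel y u * \<phi> u) / gauss_weight y" for y u
    by simp
  show ?thesis
  proof (rule KL.Fubini_integrable)
    show "(\<lambda>(y, u). jump_kernel y u / gauss_weight y * \<phi> u) \<in> borel_measurable (\<kappa> \<Otimes>\<^sub>M lborel)"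
      by measurable
    show "AE y in \<kappa>. integrable lborel (\<lambda>u. case (y, u) of (y, u) \<Rightarrow> jump_kernel y u / gauss_weight y * \<phi> u)"
      using *(1) by (auto simp: eq)
    have "\<bar>LINT u|lborel. \<bar>jump_kernel y u / gauss_weight y * \<phi> u\<bar>\<bar> \<le> C" for y
    proof -
      have "(LINT u|lborel. \<bar>jump_kernel y u / gauss_weight y * \<phi> u\<bar>) =
          (LINT u|lborel. \<bar>jump_kernel y u * \<phi> u\<bar>) / gauss_weight y"
        by (simp add: eq abs_divide)
      also have "\<dots> \<le> C"
        using *(2)[of y] C gauss_weight_pos[of y] by (cases "y = 0") (auto simp: C_def field_simps)
      finally show ?thesis by simp
    qed
    thus "integrable \<kappa> (\<lambda>y. LINT u|lborel. norm (case (y, u) of (y, u) \<Rightarrow> jump_kernel y u / gauss_weight y * \<phi> u))"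
      by (intro integrable_bounded_borel[OF finite_measure_kappa, of _ C]) auto
  qed
qed

lemma conv_kernel_locally_integrable:
  assumes "0 < a"
  shows "set_integrable lborel {-a..a} conv_kernel"
proof -
  interpret KL: pair_sigma_finite \<kappa> "lborel :: real measure" ..
  have "integrable (\<kappa> \<Otimes>\<^sub>M lborel) (\<lambda>(y, u). jump_kernel y u / gauss_weight y * indicator {-a..a} u)"
    using assms by (intro jump_kernel_pair_integrable[of _ 1 a]) (auto simp: indicator_def)
  from KL.integrable_snd[OF this]
  have 1: "integrable lborel (\<lambda>u. (LINT y|\<kappa>. jump_kernel y u / gauss_weight y) * indicator {-a..a} u)"
    by (simp only: integral_mult_left_zero)
  have "integrable lborel (\<lambda>u. indicator ({-a..a} \<inter> {0<..}) u :: real)"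
  proof (rule integrable_real_indicator)
    have "emeasure lborel ({-a..a} \<inter> {0<..}) \<le> emeasure lborel {-a..a}"
      by (intro emeasure_mono) auto
    also have "\<dots> < \<infinity>" by (simp add: emeasure_lborel_Icc_eq)
    finally show "emeasure lborel ({-a..a} \<inter> {0<..}) < \<infinity>" .
  qed simp
  hence 2: "integrable lborel (\<lambda>u. drift * indicator ({-a..a} \<inter> {0<..}) u)"
    by (rule integrable_mult_right)
  show ?thesis
    using Bochner_Integration.integrable_diff[OF 1 2]
    by (simp add: set_integrable_def conv_kernel_def algebra_simps indicator_inter_arith)
qed

text \<open>
  Fubini exchanges the integration over jumps with the representation of each single jump; the
  product integrability is \<open>jump_kernel_pair_integrable\<close>.
\<close>

lemma conv_kernel_represents:
  assumes f: "f \<in> C0_2" and supp: "\<forall>x. a < \<bar>x\<bar> \<longrightarrow> f x = 0"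
  shows "(LINT u|lborel. conv_kernel u * deriv (deriv f) (x + u)) =
    drift * deriv f x + (LINT y|\<kappa>. levy_quotient f x y)"
proof -
  interpret KL: pair_sigma_finite \<kappa> "lborel :: real measure" ..
  note f' = C0_2_D(4,5)[OF f] and f2 = C0_2_D(3)[OF f]
  note [measurable] = C0_measurable[OF f2] levy_quotient_measurable[OF C0_2_D(1)[OF f]]
  note z1 = compact_support_derivative_eq_0[OF f'(1) supp]
  note z2 = compact_support_derivative_eq_0[OF f'(2) z1]
  obtain B2 where B2: "\<And>x. \<bar>deriv (deriv f) x\<bar> \<le> B2" using C0_bounded[OF f2] by metis
  define R where "R = \<bar>a\<bar> + \<bar>x\<bar> + 1"
  have R: "0 < R" "\<And>u. R < \<bar>u\<bar> \<Longrightarrow> deriv (deriv f) (x + u) = 0" "deriv f (x + R) = 0"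
    by (auto simp: R_def intro!: z1[rule_format] z2[rule_format])
  define J where "J = (\<lambda>u. LINT y|\<kappa>. jump_kernel y u / gauss_weight y)"
  have int: "integrable (\<kappa> \<Otimes>\<^sub>M lborel)
      (\<lambda>(y, u). jump_kernel y u / gauss_weight y * deriv (deriv f) (x + u))"
    by (rule jump_kernel_pair_integrable[of _ B2 R]) (use B2 R in auto)
  have 1: "integrable lborel (\<lambda>u. J u * deriv (deriv f) (x + u))"
    using KL.integrable_snd[OF int] by (simp only: J_def integral_mult_left_zero)
  have "(LINT u|lborel. J u * deriv (deriv f) (x + u)) =
      (LINT y|\<kappa>. LINT u|lborel. jump_kernel y u / gauss_weight y * deriv (deriv f) (x + u))"
    using KL.Fubini_integral[OF int] by (simp only: J_def integral_mult_left_zero)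
  also have "\<dots> = (LINT y|\<kappa>. (f (x + y) - f x - deriv f x * sin y) / gauss_weight y)"
    by (simp add: jump_kernel_represents[OF f' C0_continuous[OF f2] supp])
  also have "\<dots> = (LINT y|\<kappa>. levy_quotient f x y)"
  proof (rule integral_cong_AE)
    note [measurable] = C0_measurable[OF C0_2_D(1)[OF f]]
    show "(\<lambda>y. (f (x + y) - f x - deriv f x * sin y) / gauss_weight y) \<in> borel_measurable \<kappa>"
      by measurable
    show "AE y in \<kappa>. (f (x + y) - f x - deriv f x * sin y) / gauss_weight y = levy_quotient f x y"
      using AE_kappa_nonzero by eventually_elim (simp add: levy_quotient_def)
  qed measurable
  finally have J: "(LINT u|lborel. J u * deriv (deriv f) (x + u)) = (LINT y|\<kappa>. levy_quotient f x y)" .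
  have f'': "((\<lambda>u. deriv f (x + u)) has_real_derivative deriv (deriv f) (x + u)) (at u)" for u
    using DERIV_translate[OF f'(2)] .
  have cont'': "isCont (\<lambda>u. deriv (deriv f) (x + u)) u" for u
    by (rule isCont_o2[OF _ C0_continuous[OF f2]]) simp
  have "has_bochner_integral lborel (\<lambda>u. deriv (deriv f) (x + u) * indicator {0..R} u)
      (deriv f (x + R) - deriv f (x + 0))"
    using R(1)
    by (intro has_bochner_integral_FTC_Icc_real f'' cont'') auto
  hence "has_bochner_integral lborel (\<lambda>u. indicator {0<..} u * deriv (deriv f) (x + u)) (- deriv f x)"
  proof (subst (asm) has_bochner_integral_cong_AE)
    show "AE u in lborel. deriv (deriv f) (x + u) * indicator {0..R} u =
        indicator {0<..} u * deriv (deriv f) (x + u)"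
      using AE_lborel_singleton[of 0] by eventually_elim (use R(2) in \<open>force simp: indicator_def\<close>)
  qed (use R in auto)
  hence 2: "integrable lborel (\<lambda>u. indicator {0<..} u * deriv (deriv f) (x + u))"
    "(LINT u|lborel. indicator {0<..} u * deriv (deriv f) (x + u)) = - deriv f x"
    by (auto simp: has_bochner_integral_iff)
  have "(LINT u|lborel. conv_kernel u * deriv (deriv f) (x + u)) =
      (LINT u|lborel. J u * deriv (deriv f) (x + u) - drift * (indicator {0<..} u * deriv (deriv f) (x + u)))"
    by (simp add: conv_kernel_def J_def algebra_simps)
  also have "\<dots> = (LINT u|lborel. J u * deriv (deriv f) (x + u)) - drift * (- deriv f x)"
    using 1 2 by simp
  finally show ?thesis using J by simp
qed

text \<open>
  The convolution kernel depends on \<open>y - x\<close> only, so that differentiation of \<open>S f'\<close> in \<open>x\<close> falls on \<open>f'\<close>.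
\<close>

theorem S_op_has_derivative:
  assumes f: "f \<in> C0_2" and supp: "\<forall>x. a < \<bar>x\<bar> \<longrightarrow> f x = 0"
  shows "(S_op A conv_kernel (deriv f) has_real_derivative levy_generator f x) (at x)"
proof -
  note f' = C0_2_D(4,5)[OF f] and f2 = C0_2_D(3)[OF f]
  obtain B2 where B2: "\<And>x. \<bar>deriv (deriv f) x\<bar> \<le> B2" using C0_bounded[OF f2] by metis
  have S: "S_op A conv_kernel (deriv f) =
      (\<lambda>x. A / 2 * deriv f x + (LINT u|lborel. conv_kernel u * deriv f (x + u)))"
  proof
    fix x
    show "S_op A conv_kernel (deriv f) x =
        A / 2 * deriv f x + (LINT u|lborel. conv_kernel u * deriv f (x + u))"
      unfolding S_op_def by (subst lborel_integral_real_affine[of 1 _ x]) simp_all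
  qed
  have "((\<lambda>x. LINT u|lborel. conv_kernel u * deriv f (x + u)) has_real_derivative
      (LINT u|lborel. conv_kernel u * deriv (deriv f) (x + u))) (at x)"
    by (rule has_derivative_locally_integrable_convolution
        [OF conv_kernel_locally_integrable f'(2) B2 C0_measurable[OF f2] compact_support_derivative_eq_0[OF f'(1) supp]])
  hence "(S_op A conv_kernel (deriv f) has_real_derivative
      A / 2 * deriv (deriv f) x + (LINT u|lborel. conv_kernel u * deriv (deriv f) (x + u))) (at x)"
    unfolding S by (auto intro!: derivative_eq_intros f'(2))
  moreover have "A / 2 * deriv (deriv f) x + (LINT u|lborel. conv_kernel u * deriv (deriv f) (x + u)) = levy_generator f x"
    unfolding conv_kernel_represents[OF f supp] levy_generator_def by simp
  ultimately show ?thesis by simp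
qed

end

section \<open>The generator of a Levy process in convolution form\<close>

theorem theorem2p5:
  fixes M :: "'a measure" and X :: "real \<Rightarrow> 'a \<Rightarrow> real"
    and A \<gamma> :: real and \<mu> :: "real measure"
  assumes "levy_process M X"
    and "levy_khinchine_triplet M X A \<gamma> \<mu>"
  shows "\<exists>k :: real \<Rightarrow> real.
    (\<forall>a>0. set_integrable lborel {-a..a} k) \<and>
    (\<forall>f\<in>C0_2. (\<exists>a>0. \<forall>x. x \<notin> {-a..a} \<longrightarrow> f x = 0) \<longrightarrow>
      f \<in> generator_domain (transition_op M X) \<and>
      (\<forall>x. (S_op A k (deriv f) has_real_derivative generator (transition_op M X) f x) (at x)))"
proof -
  interpret levy_process M X by fact
  interpret levy_khinchine_laws "\<lambda>t. distr M borel (X t)" A \<gamma> \<mu>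
  proof (rule levy_khinchine_laws.intro)
    show "real_distribution (distr M borel (X t))" if "0 \<le> t" for t
      using random_variable_X[OF that] by (rule real_distribution_distr)
  qed (use assms(2) in \<open>auto simp: levy_khinchine_triplet_def\<close>)
  show ?thesis
  proof (intro exI[of _ conv_kernel] conjI ballI impI allI)
    fix a :: real assume "0 < a"
    thus "set_integrable lborel {-a..a} conv_kernel" by (rule conv_kernel_locally_integrable)
  next
    fix f assume f: "f \<in> C0_2" and "\<exists>a>0. \<forall>x. x \<notin> {-a..a} \<longrightarrow> f x = 0"
    then obtain a where a: "\<And>x. x \<notin> {-a..a} \<Longrightarrow> f x = 0" by blast
    have supp: "\<forall>x. a < \<bar>x\<bar> \<longrightarrow> f x = 0"
      by (intro allI impI a) auto
    have T: "transition_op M X t f x = (LINT y|distr M borel (X t). f (x + y))" if "0 < t" for t x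
    proof -
      note [measurable] = random_variable_X[OF less_imp_le[OF that]] C0_measurable[OF C0_2_D(1)[OF f]]
      show ?thesis
        by (simp add: transition_op_def transition_prob_def integral_distr)
    qed
    have "generates (transition_op M X) f (levy_generator f)"
      by (rule generates_levy_generator(1)[where T = "transition_op M X", OF f T])
    thus "f \<in> generator_domain (transition_op M X)"
      by (auto simp: generator_domain_def)
    fix x
    have "generator (transition_op M X) f = levy_generator f"
      by (rule generates_levy_generator(2)[where T = "transition_op M X", OF f T])
    thus "(S_op A conv_kernel (deriv f) has_real_derivative generator (transition_op M X) f x) (at x)"
      using S_op_has_derivative[OF f supp, of x] by simp
  qed
qed

end
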